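(* Let $F$ be a field of characteristic zero, $m\ge 2$, $G=\mathbb{Z}^{\lfloor m/2\rfloor}$, and consider $UT_m(F)$ with the finest grading and the reflection involution $\ast$. Then, as $n\to\infty$, $$c_n^{G,\ast}(UT_m(F))\sim K_m\,n^{m-1}m^n,\qquad K_m=\frac{2^{\lfloor (m-1)/2\rfloor}}{m^{m-1}}.$$ In particular, $\mathrm{exp}^{G,\ast}(UT_m(F))=m$.
   Context: $UT_m(F)$ is the algebra of $m\times m$ upper triangular matrices, with elementary matrices $E_{i,j}$, $i\le j$. For an abelian group $G$ (written additively) the elementary grading induced by $(g_1,\dots,g_m)\in G^m$ is the $G$-grading with $\deg E_{i,j}=g_i-g_j$. The finest grading on $UT_m(F)$ is the elementary $\mathbb{Z}^{\lfloor m/2\rfloor}$-grading induced by $(e_1,\dots,e_r,0,e_r-e_{r-1},\dots,e_r-e_1)$ if $m=2r$ and by $(e_1,\dots,e_r,0,-e_r,\dots,-e_1)$ if $m=2r+1$, where $e_1,\dots,e_r$ is the standard basis of $\mathbb{Z}^r$. The reflection involution is the linear map with $E_{i,j}^\ast=E_{m+1-j,m+1-i}$. For a $G$-graded algebra $A=\oplus_gA_g$ with involution $\ast$ preserving each $A_g$: $F_{G,\ast}\langle X\rangle$ is the free associative algebra on indeterminates $x_{i,g},x_{i,g}^\ast$ ($i\in\mathbb{N},g\in G$); a polynomial is a $(G,\ast)$-identity for $A$ if it vanishes whenever each $x_{i,g}$ is replaced by an element $a_{i,g}\in A_g$ and $x_{i,g}^\ast$ by $a_{i,g}^\ast$; $T_{G,\ast}(A)$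 is the set of these. $P_n^{G,\ast}$ is the span of the monomials $x_{\sigma(1),g_1}^{\delta_1}\cdots x_{\sigma(n),g_n}^{\delta_n}$, $\sigma\in S_n$, $g_i\in G$, $\delta_i\in\{\emptyset,\ast\}$ (here $x^{\emptyset}=x$). Then $c_n^{G,\ast}(A)=\dim P_n^{G,\ast}/(P_n^{G,\ast}\cap T_{G,\ast}(A))$ and $\mathrm{exp}^{G,\ast}(A)=\lim_{n\to\infty}\sqrt[n]{c_n^{G,\ast}(A)}$ when the limit exists. $a_n\sim b_n$ means $a_n/b_n\to1$. *)

theory Defs
  imports
    "Jordan_Normal_Form.VS_Connect"
    "HOL-Algebra.AbelCoset"
    "HOL-Library.Poly_Mapping"
    "HOL-Library.Landau_Symbols"
    "HOL-Combinatorics.Permutations"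
begin

section \<open>Graded identities with involution\<close>

text \<open>Algebras over a field (a type of class \<open>field\<close>) are \<open>module\<close> records, whose
  fields include \<open>mult\<close> and \<open>one\<close>. A grading of such an algebra is given by the set
  \<open>G\<close> of all degrees and by the family \<open>C\<close> of its homogeneous components. The group
  structure of \<open>G\<close> plays no role in the notion of a graded identity.\<close>

text \<open>\<open>Indet i g False\<close> is $x_{i,g}$ and \<open>Indet i g True\<close> is $x_{i,g}^\ast$.\<close>

datatype 'g indet = Indet nat (indet_deg: 'g) bool

text \<open>The free algebra $F_{G,\ast}\langle X\rangle$: finitely supported functions on the words in
  the indeterminates with degree in \<open>G\<close>.\<close>

definition free_star_algebra :: "'g set \<Rightarrow> ('f::field, 'g indet list \<Rightarrow>\<^sub>0 'f) module" where
  "free_star_algebra G = \<lparr>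
     carrier = {f. \<forall>w \<in> Poly_Mapping.keys f. \<forall>x \<in> set w. indet_deg x \<in> G},
     mult = (\<lambda>f h. \<Sum>u \<in> Poly_Mapping.keys f. \<Sum>v \<in> Poly_Mapping.keys h.
               Poly_Mapping.single (u @ v) (Poly_Mapping.lookup f u * Poly_Mapping.lookup h v)),
     one = Poly_Mapping.single [] 1,
     zero = 0,
     add = (+),
     smult = (\<lambda>c. Poly_Mapping.map ((*) c))\<rparr>"

fun subst_indet :: "('a \<Rightarrow> 'a) \<Rightarrow> (nat \<Rightarrow> 'g \<Rightarrow> 'a) \<Rightarrow> 'g indet \<Rightarrow> 'a" where
  "subst_indet star a (Indet i g starred) = (if starred then star (a i g) else a i g)"

definition subst_word ::
    "('f, 'a) module \<Rightarrow> ('a \<Rightarrow> 'a) \<Rightarrow> (nat \<Rightarrow> 'g \<Rightarrow> 'a) \<Rightarrow> 'g indet list \<Rightarrow> 'a" where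
  "subst_word A star a w = foldr (mult A) (map (subst_indet star a) w) \<one>\<^bsub>A\<^esub>"

definition subst_poly ::
    "('f::field, 'a) module \<Rightarrow> ('a \<Rightarrow> 'a) \<Rightarrow> (nat \<Rightarrow> 'g \<Rightarrow> 'a) \<Rightarrow> ('g indet list \<Rightarrow>\<^sub>0 'f) \<Rightarrow> 'a" where
  "subst_poly A star a f =
     (\<Oplus>\<^bsub>A\<^esub> w \<in> Poly_Mapping.keys f. Poly_Mapping.lookup f w \<odot>\<^bsub>A\<^esub> subst_word A star a w)"

definition star_identities ::
    "('f::field, 'a) module \<Rightarrow> ('a \<Rightarrow> 'a) \<Rightarrow> 'g set \<Rightarrow> ('g \<Rightarrow> 'a set) \<Rightarrow> ('g indet list \<Rightarrow>\<^sub>0 'f) set" where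
  "star_identities A star G C =
     {f \<in> carrier (free_star_algebra G).
        \<forall>a. (\<forall>i. \<forall>g \<in> G. a i g \<in> C g) \<longrightarrow> subst_poly A star a f = \<zero>\<^bsub>A\<^esub>}"

definition multilinear_polys :: "'g set \<Rightarrow> nat \<Rightarrow> ('g indet list \<Rightarrow>\<^sub>0 'f::field) set" where
  "multilinear_polys G n = LinearCombinations.module.span class_ring (free_star_algebra G)
     {Poly_Mapping.single (map (\<lambda>k. Indet (\<sigma> k) (g k) (\<delta> k)) [1..<Suc n]) 1 | \<sigma> g \<delta>.
        \<sigma> permutes {1..n} \<and> (\<forall>k \<in> {1..n}. g k \<in> G)}"

text \<open>The quotient space $V/U$, whose elements are the cosets $U + v$.\<close>

definition quotient_space :: "('f, 'a) module \<Rightarrow> 'a set \<Rightarrow> ('f, 'a set) module" where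
  "quotient_space V U = \<lparr>
     carrier = a_rcosets\<^bsub>V\<^esub> U,
     mult = undefined,
     one = undefined,
     zero = U,
     add = set_add V,
     smult = (\<lambda>c X. U <+>\<^bsub>V\<^esub> ((\<lambda>v. c \<odot>\<^bsub>V\<^esub> v) ` X))\<rparr>"

definition star_codim ::
    "('f::field, 'a) module \<Rightarrow> ('a \<Rightarrow> 'a) \<Rightarrow> 'g set \<Rightarrow> ('g \<Rightarrow> 'a set) \<Rightarrow> nat \<Rightarrow> nat" where
  "star_codim A star G C n = vectorspace.dim class_ring
     (quotient_space
        ((free_star_algebra G)\<lparr>carrier := multilinear_polys G n\<rparr>)
        (multilinear_polys G n \<inter> star_identities A star G C))"

text \<open>Meaningful only if the limit exists.\<close>

definition star_exp ::
    "('f::field, 'a) module \<Rightarrow> ('a \<Rightarrow> 'a) \<Rightarrow> 'g set \<Rightarrow> ('g \<Rightarrow> 'a set) \<Rightarrow> real" where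
  "star_exp A star G C = lim (\<lambda>n. root n (real (star_codim A star G C n)))"


section \<open>Upper triangular matrices\<close>

text \<open>Matrix rows and columns are numbered from 0, so \<open>elem_mat m i j\<close> is
  $E_{i+1,j+1}$.\<close>

definition UT :: "'f::field itself \<Rightarrow> nat \<Rightarrow> ('f, 'f mat) module" where
  "UT ty m = (module_mat ty m m)\<lparr>carrier := {A \<in> carrier_mat m m. upper_triangular A}\<rparr>"

definition elem_mat :: "nat \<Rightarrow> nat \<Rightarrow> nat \<Rightarrow> 'f::field mat" where
  "elem_mat m i j = mat m m (\<lambda>(k, l). if k = i \<and> l = j then 1 else 0)"

text \<open>The component of degree \<open>g\<close> in the elementary grading induced by the tuple \<open>gs\<close>.\<close>

definition elementary_component ::
    "'f::field itself \<Rightarrow> nat \<Rightarrow> 'g::minus list \<Rightarrow> 'g \<Rightarrow> 'f mat set" where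
  "elementary_component ty m gs g = LinearCombinations.module.span class_ring (UT ty m)
     {elem_mat m i j | i j. i \<le> j \<and> j < m \<and> gs ! i - gs ! j = g}"

text \<open>The group $\mathbb{Z}^r$ is \<open>carrier_vec r\<close>, and $e_i$ is \<open>unit_vec r (i - 1)\<close>.\<close>

definition finest_tuple :: "nat \<Rightarrow> int vec list" where
  "finest_tuple m = (let r = m div 2 in
     map (unit_vec r) [0..<r] @ [0\<^sub>v r] @
     (if even m then map (\<lambda>i. unit_vec r (r - 1) - unit_vec r i) (rev [0..<r - 1])
      else map (\<lambda>i. - unit_vec r i) (rev [0..<r])))"

text \<open>Transposition along the anti-diagonal.\<close>

definition reflection :: "nat \<Rightarrow> 'f::field mat \<Rightarrow> 'f mat" where
  "reflection m A = mat m m (\<lambda>(i, j). A $$ (m - 1 - j, m - 1 - i))"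

lemma reflection_elem_mat:
  assumes "i < m" "j < m"
  shows "reflection m (elem_mat m i j) = elem_mat m (m - 1 - j) (m - 1 - i)"
  using assms by (intro eq_matI) (auto simp: reflection_def elem_mat_def)

definition UT_codim :: "'f::field itself \<Rightarrow> nat \<Rightarrow> nat \<Rightarrow> nat" where
  "UT_codim ty m = star_codim (UT ty m) (reflection m) (carrier_vec (m div 2))
     (elementary_component ty m (finest_tuple m))"

definition UT_exp :: "'f::field itself \<Rightarrow> nat \<Rightarrow> real" where
  "UT_exp ty m = star_exp (UT ty m) (reflection m) (carrier_vec (m div 2))
     (elementary_component ty m (finest_tuple m))"

end

theory Submission
  imports Defs "HOL-Real_Asymp.Real_Asymp"
begin

text \<open>By multilinearity, a polynomial \<open>f\<close> in \<open>P\<^sub>n\<close> is determined modulo the identities by its values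
  on the tests, i.e. the substitutions of elementary matrices for the variables. So the codimension
  is the rank of the matrix that lists the entries of the values of all words on all tests. A word
  has the value 0 unless it spells a path in the order of the matrix indices, so at most \<open>m - 1\<close>
  variables are replaced by off-diagonal matrices. There are only \<open>O(n\<^sup>m\<^sup>-\<^sup>2 m\<^sup>n)\<close> tests with fewer than
  \<open>m - 1\<close> of them. If there are \<open>m - 1\<close>, then every word with nonzero value on the test walks
  through all the steps \<open>E\<^sub>i\<^sub>,\<^sub>i\<^sub>+\<^sub>1\<close> and is nonzero on no other test and at no other entry, so these
  tests contribute their exact number to the rank. They are counted by distributing the variables
  to the orbits of steps under the reflection: each of the \<open>\<lfloor>(m - 1) / 2\<rfloor>\<close> orbits of size 2
  contributes a factor \<open>(N choose 2) 2\<^sup>2 \<sim> 2 N\<^sup>2\<close>, the orbit of size 1 (for even \<open>m\<close>) a factor \<open>N\<close>,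
  and each of the remaining variables has \<open>m\<close> diagonal values.\<close>


section \<open>Dimensions of quotient spaces\<close>

text \<open>A subset of \<open>X\<close> that is independent in the subspace is independent in
  \<open>V\<close>, so its size is at most \<open>dim\<close>. Hence a maximal one exists, and it is
  a basis of \<open>X\<close>.\<close>

lemma (in vectorspace) subspace_fin_dim:
  assumes X: "VectorSpace.subspace K X V" and fd: fin_dim
  shows "vectorspace.fin_dim K (vs X)" and "vectorspace.dim K (vs X) \<le> dim"
proof -
  interpret X: vectorspace K "vs X" using X by (rule subspace_is_vs)
  have subm: "submodule K X V" using X by simp
  have XV: "X \<subseteq> carrier V" using subm by (simp add: submodule_def)
  define P where "P S \<longleftrightarrow> S \<subseteq> carrier (vs X) \<and> X.lin_indpt S" for S
  have *: "finite S \<and> card S \<le> dim" if "P S" for S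
  proof -
    have "S \<subseteq> X" "X.lin_indpt S" using that by (auto simp: P_def)
    then have "lin_indpt S" using span_li_not_depend(2)[OF _ subm] by blast
    then show ?thesis using li_le_dim[OF fd, of S] \<open>S \<subseteq> X\<close> XV by blast
  qed
  have "P {}"
    by (auto simp: P_def X.lin_dep_def)
  then obtain A where A: "finite A" "maximal A P"
    using maximal_exists[of P dim "{}"] * by blast
  have basis: "X.basis A"
    using A(2) unfolding P_def by (rule X.max_li_is_basis)
  then show "X.fin_dim"
    using A(1) by (auto simp: X.fin_dim_def X.basis_def)
  have "P A" using A(2) by (simp add: maximal_def)
  then show "X.dim \<le> dim"
    using X.dim_basis[OF A(1) basis] * by simp
qed

text \<open>\<open>Q\<close> is not assumed to be a vector space: the axioms are carried over along
  \<open>\<phi>\<close> together with the dimension. This suits \<open>quotient_space\<close>, which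
  is a bare record of operations on cosets.\<close>

lemma vectorspace_dim_transport:
  assumes W: "vectorspace K W" "vectorspace.fin_dim K W"
    and bij: "bij_betw \<phi> (carrier W) (carrier Q)"
    and add: "\<And>x y. x \<in> carrier W \<Longrightarrow> y \<in> carrier W \<Longrightarrow> \<phi> (x \<oplus>\<^bsub>W\<^esub> y) = \<phi> x \<oplus>\<^bsub>Q\<^esub> \<phi> y"
    and smult: "\<And>c x. c \<in> carrier K \<Longrightarrow> x \<in> carrier W \<Longrightarrow> \<phi> (c \<odot>\<^bsub>W\<^esub> x) = c \<odot>\<^bsub>Q\<^esub> \<phi> x"
    and zero: "\<phi> \<zero>\<^bsub>W\<^esub> = \<zero>\<^bsub>Q\<^esub>"
  shows "vectorspace.dim K Q = vectorspace.dim K W"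
proof -
  interpret W: vectorspace K W by fact
  have im: "carrier Q = \<phi> ` carrier W" using bij by (simp add: bij_betw_def)
  have Q: "vectorspace K Q"
    apply (rule vs_criteria)
    unfolding im
    apply (rule W.field_axioms)
    apply (force simp flip: zero add smult)
    apply (force simp flip: zero add smult)
    subgoal
      apply (rule ballI, erule imageE, simp)
      subgoal for v x
      apply (rule bexI[of _ "\<ominus>\<^bsub>W\<^esub> x"])
      apply (simp flip: add zero add: W.r_neg)
      by simp
    done
    apply (force simp flip: zero add smult)
    apply (force simp flip: zero add smult simp: W.a_comm)
    apply (force simp flip: zero add smult simp: W.a_assoc)
    apply (force simp flip: zero add smult)
    apply (force simp flip: zero add smult simp: W.smult_assoc1)
    apply (force simp flip: zero add smult)
    apply (force simp flip: zero add smult simp: W.smult_l_distr)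
    apply (force simp flip: zero add smult simp: W.smult_r_distr)
    done
  interpret Q: vectorspace K Q by fact
  interpret linear_map K W Q \<phi>
    by unfold_locales (auto simp: LinearCombinations.module_hom_def im add smult)
  show ?thesis
    using dim_eq[OF W(2)] bij by (simp add: bij_betw_def)
qed

text \<open>First isomorphism theorem: the cosets of the kernel \<open>U\<close> are the nonempty
  fibres of \<open>T\<close>, and sending a point of the image to its fibre is the
  isomorphism.\<close>

lemma quotient_space_dim:
  assumes lin: "linear_map K V W T" and fd: "vectorspace.fin_dim K W"
    and U: "U = {v \<in> carrier V. T v = \<zero>\<^bsub>W\<^esub>}"
  shows "vectorspace.dim K (quotient_space V U) = vectorspace.dim K (W\<lparr>carrier := T ` carrier V\<rparr>)"
proof -
  interpret linear_map K V W T by fact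
  define I where "I = W\<lparr>carrier := T ` carrier V\<rparr>"
  have im: "T ` carrier V = imT" by (simp add: im_def)
  have I: "vectorspace K I" "vectorspace.fin_dim K I"
    unfolding I_def im using imT_is_subspace W.subspace_is_vs W.subspace_fin_dim fd by blast+
  define \<phi> where "\<phi> w = {v \<in> carrier V. T v = w}" for w
  have coset: "U +>\<^bsub>V\<^esub> v = \<phi> (T v)" if v: "v \<in> carrier V" for v
  proof (intro equalityI subsetI)
    fix x assume "x \<in> U +>\<^bsub>V\<^esub> v"
    then show "x \<in> \<phi> (T v)" using v by (auto simp: a_r_coset_def' U \<phi>_def)
  next
    fix x assume "x \<in> \<phi> (T v)"
    then have x: "x \<in> carrier V" "T x = T v" by (auto simp: \<phi>_def)
    have "x \<ominus>\<^bsub>V\<^esub> v \<in> U" using x v by (auto simp: U a_minus_def W.module.M.r_neg)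
    moreover have "x = (x \<ominus>\<^bsub>V\<^esub> v) \<oplus>\<^bsub>V\<^esub> v"
      using x v by (simp add: a_minus_def V.module.M.a_assoc V.module.M.l_neg)
    ultimately show "x \<in> U +>\<^bsub>V\<^esub> v" by (auto simp: a_r_coset_def')
  qed
  have \<phi>_add: "\<phi> (T v) <+>\<^bsub>V\<^esub> \<phi> (T w) = \<phi> (T v \<oplus>\<^bsub>W\<^esub> T w)"
    if v: "v \<in> carrier V" and w: "w \<in> carrier V" for v w
  proof (intro equalityI subsetI)
    fix x assume "x \<in> \<phi> (T v) <+>\<^bsub>V\<^esub> \<phi> (T w)"
    then show "x \<in> \<phi> (T v \<oplus>\<^bsub>W\<^esub> T w)" by (auto simp: set_add_def' \<phi>_def)
  next
    fix x assume "x \<in> \<phi> (T v \<oplus>\<^bsub>W\<^esub> T w)"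
    then have x: "x \<in> carrier V" "T x = T v \<oplus>\<^bsub>W\<^esub> T w" by (auto simp: \<phi>_def)
    have "x \<ominus>\<^bsub>V\<^esub> w \<in> \<phi> (T v)"
      using x v w by (auto simp: \<phi>_def a_minus_def W.module.M.a_assoc W.module.M.r_neg)
    moreover have "x = (x \<ominus>\<^bsub>V\<^esub> w) \<oplus>\<^bsub>V\<^esub> w"
      using x w by (simp add: a_minus_def V.module.M.a_assoc V.module.M.l_neg)
    moreover have "w \<in> \<phi> (T w)" using w by (simp add: \<phi>_def)
    ultimately show "x \<in> \<phi> (T v) <+>\<^bsub>V\<^esub> \<phi> (T w)" by (auto simp: set_add_def')
  qed
  have U_\<phi>: "U = \<phi> (T \<zero>\<^bsub>V\<^esub>)" by (auto simp: U \<phi>_def)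
  \<comment> \<open>For \<open>c = 0\<close> scaling maps the whole fibre to the zero vector; the
    summand \<open>U\<close> fills this up to a coset.\<close>
  have \<phi>_smult: "U <+>\<^bsub>V\<^esub> ((\<lambda>v. c \<odot>\<^bsub>V\<^esub> v) ` \<phi> (T v)) = \<phi> (c \<odot>\<^bsub>W\<^esub> T v)"
    if c: "c \<in> carrier K" and v: "v \<in> carrier V" for c v
  proof (intro equalityI subsetI)
    fix x assume "x \<in> U <+>\<^bsub>V\<^esub> ((\<lambda>v. c \<odot>\<^bsub>V\<^esub> v) ` \<phi> (T v))"
    then show "x \<in> \<phi> (c \<odot>\<^bsub>W\<^esub> T v)" using c v by (auto simp: set_add_def' \<phi>_def U)
  next
    fix x assume "x \<in> \<phi> (c \<odot>\<^bsub>W\<^esub> T v)"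
    then have "x \<in> \<phi> (T \<zero>\<^bsub>V\<^esub> \<oplus>\<^bsub>W\<^esub> T (c \<odot>\<^bsub>V\<^esub> v))" using c v by simp
    then have x: "x \<in> carrier V" "T x = T (c \<odot>\<^bsub>V\<^esub> v)" using c v by (auto simp: \<phi>_def)
    have "x \<ominus>\<^bsub>V\<^esub> c \<odot>\<^bsub>V\<^esub> v \<in> U" using x c v by (auto simp: U a_minus_def W.module.M.r_neg)
    moreover have "x = (x \<ominus>\<^bsub>V\<^esub> c \<odot>\<^bsub>V\<^esub> v) \<oplus>\<^bsub>V\<^esub> c \<odot>\<^bsub>V\<^esub> v"
      using x c v by (simp add: a_minus_def V.module.M.a_assoc V.module.M.l_neg)
    moreover have "v \<in> \<phi> (T v)" using v by (simp add: \<phi>_def)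
    ultimately show "x \<in> U <+>\<^bsub>V\<^esub> ((\<lambda>v. c \<odot>\<^bsub>V\<^esub> v) ` \<phi> (T v))"
      by (auto simp: set_add_def')
  qed
  have "vectorspace.dim K (quotient_space V U) = vectorspace.dim K I"
  proof (rule vectorspace_dim_transport[OF I, of \<phi>])
    have "carrier (quotient_space V U) = \<phi> ` carrier I"
      by (auto simp: quotient_space_def A_RCOSETS_def' I_def coset)
    moreover have "inj_on \<phi> (carrier I)"
    proof (rule inj_onI)
      fix x y assume "x \<in> carrier I" "y \<in> carrier I" "\<phi> x = \<phi> y"
      then obtain v where "v \<in> carrier V" "x = T v" by (auto simp: I_def)
      then have "v \<in> \<phi> x" by (simp add: \<phi>_def)
      then show "x = y" using \<open>\<phi> x = \<phi> y\<close> by (auto simp: \<phi>_def)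
    qed
    ultimately show "bij_betw \<phi> (carrier I) (carrier (quotient_space V U))"
      by (simp add: bij_betw_def)
  next
    fix x y assume "x \<in> carrier I" "y \<in> carrier I"
    then show "\<phi> (x \<oplus>\<^bsub>I\<^esub> y) = \<phi> x \<oplus>\<^bsub>quotient_space V U\<^esub> \<phi> y"
      by (auto simp: quotient_space_def I_def \<phi>_add)
  next
    fix c x assume "c \<in> carrier K" "x \<in> carrier I"
    then show "\<phi> (c \<odot>\<^bsub>I\<^esub> x) = c \<odot>\<^bsub>quotient_space V U\<^esub> \<phi> x"
      by (auto simp: quotient_space_def I_def \<phi>_smult)
  next
    show "\<phi> \<zero>\<^bsub>I\<^esub> = \<zero>\<^bsub>quotient_space V U\<^esub>"
      using U_\<phi> by (simp add: quotient_space_def I_def)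
  qed
  then show ?thesis by (simp add: I_def)
qed

text \<open>The values \<open>\<Psi> v s\<close> embed the quotient into the space of vectors
  indexed by \<open>S\<close>, which gives the upper bound. A vector dual to \<open>s\<close> puts a
  unit vector into the image, and unit vectors are independent, which gives the lower bound.\<close>

lemma quotient_space_dim_bounds:
  fixes V :: "('f::field, 'v) module" and \<Psi> :: "'v \<Rightarrow> 's \<Rightarrow> 'f"
  assumes V: "vectorspace class_ring V" and S: "finite S"
    and add: "\<And>u v s. u \<in> carrier V \<Longrightarrow> v \<in> carrier V \<Longrightarrow> s \<in> S \<Longrightarrow> \<Psi> (u \<oplus>\<^bsub>V\<^esub> v) s = \<Psi> u s + \<Psi> v s"
    and smult: "\<And>c v s. v \<in> carrier V \<Longrightarrow> s \<in> S \<Longrightarrow> \<Psi> (c \<odot>\<^bsub>V\<^esub> v) s = c * \<Psi> v s"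
    and U: "U = {v \<in> carrier V. \<forall>s\<in>S. \<Psi> v s = 0}"
  shows "vectorspace.dim class_ring (quotient_space V U) \<le> card S"
    and "\<And>H. H \<subseteq> S \<Longrightarrow> (\<And>s. s \<in> H \<Longrightarrow> \<exists>v\<in>carrier V. \<forall>s'\<in>S. \<Psi> v s' = of_bool (s' = s))
      \<Longrightarrow> card H \<le> vectorspace.dim class_ring (quotient_space V U)"
proof -
  let ?K = "class_ring :: 'f ring"
  define N where "N = card S"
  obtain h where h: "bij_betw h {..<N} S"
    using ex_bij_betw_nat_finite[OF S] by (auto simp: N_def atLeast0LessThan)
  interpret V: vectorspace ?K V by fact
  interpret W: vec_space "TYPE('f)" N .
  let ?W = "module_vec TYPE('f) N"
  define T where "T v = vec N (\<lambda>i. \<Psi> v (h i))" for v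
  have hS: "h i \<in> S" if "i < N" for i using h that by (auto simp: bij_betw_def)
  have lin: "linear_map ?K V ?W T"
    by unfold_locales (auto simp: LinearCombinations.module_hom_def T_def module_vec_simps add smult hS)
  interpret linear_map ?K V ?W T by fact
  have U': "U = {v \<in> carrier V. T v = \<zero>\<^bsub>?W\<^esub>}"
  proof -
    have "(\<forall>s\<in>S. \<Psi> v s = 0) \<longleftrightarrow> T v = 0\<^sub>v N" for v
    proof
      assume "T v = 0\<^sub>v N"
      then have "\<Psi> v (h i) = 0" if "i < N" for i
        using that by (metis T_def index_vec index_zero_vec(1))
      moreover have "S = h ` {..<N}" using h by (simp add: bij_betw_def)
      ultimately show "\<forall>s\<in>S. \<Psi> v s = 0" by auto
    qed (auto simp: T_def hS)
    then show ?thesis by (simp add: U module_vec_simps)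
  qed
  have dim: "vectorspace.dim ?K (quotient_space V U) = vectorspace.dim ?K (W.vs (T ` carrier V))"
    by (rule quotient_space_dim[OF lin _ U']) simp
  have sub: "VectorSpace.subspace ?K (T ` carrier V) ?W"
    using imT_is_subspace by (simp add: im_def)
  note fd = W.subspace_fin_dim[OF sub W.fin_dim]
  show "vectorspace.dim ?K (quotient_space V U) \<le> card S"
    using fd(2) by (simp add: dim W.dim_is_n flip: N_def)
  fix H assume H: "H \<subseteq> S" and ex: "\<And>s. s \<in> H \<Longrightarrow> \<exists>v\<in>carrier V. \<forall>s'\<in>S. \<Psi> v s' = of_bool (s' = s)"
  interpret I: vectorspace ?K "W.vs (T ` carrier V)"
    using sub by (rule W.subspace_is_vs)
  define J where "J = {i. i < N \<and> h i \<in> H}"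
  have "bij_betw h J H"
    using h H by (force simp: J_def bij_betw_def inj_on_def)
  then have card_J: "card J = card H" by (rule bij_betw_same_card)
  define B :: "'f vec set" where "B = unit_vec N ` J"
  have "inj_on (unit_vec N :: nat \<Rightarrow> 'f vec) J"
    by (auto simp: inj_on_def J_def)
  then have card_B: "card B = card H" by (simp add: B_def card_image card_J)
  have B_im: "B \<subseteq> T ` carrier V"
  proof
    fix b assume "b \<in> B"
    then obtain i where i: "b = unit_vec N i" "i < N" "h i \<in> H" by (auto simp: B_def J_def)
    then obtain v where v: "v \<in> carrier V" "\<forall>s'\<in>S. \<Psi> v s' = of_bool (s' = h i)" using ex by blast
    have "T v = b"
    proof (rule eq_vecI)
      fix j assume "j < dim_vec b"
      then have j: "j < N" by (simp add: i)
      have "h j = h i \<longleftrightarrow> j = i" using h j i by (auto simp: bij_betw_def inj_on_def)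
      then show "T v $ j = b $ j" using v j hS i by (simp add: T_def)
    qed (simp add: T_def i)
    then show "b \<in> T ` carrier V" using v by auto
  qed
  have "W.lin_indpt B"
  proof (rule W.subset_li_is_li)
    show "W.lin_indpt (set (unit_vecs N))" using W.unit_vecs_basis by (simp add: W.basis_def)
    show "B \<subseteq> set (unit_vecs N)" by (auto simp: B_def J_def unit_vecs_def)
  qed
  then have "I.lin_indpt B"
    using W.span_li_not_depend(2)[OF B_im] sub by simp
  then show "card H \<le> vectorspace.dim ?K (quotient_space V U)"
    using I.li_le_dim(2)[OF fd(1), of B] B_im card_B by (simp add: dim)
qed


section \<open>Multilinear polynomials\<close>

lemma lookup_map_mult [simp]: "Poly_Mapping.lookup (Poly_Mapping.map ((*) c) f) x = (c::'f::field) * Poly_Mapping.lookup f x"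
  by (simp add: Poly_Mapping.map.rep_eq when_def)

lemma vectorspace_free_star_algebra:
  "vectorspace (class_ring :: 'f::field ring) (free_star_algebra G :: ('f, 'g indet list \<Rightarrow>\<^sub>0 'f) module)"
proof (rule vs_criteria)
  let ?V = "free_star_algebra G :: ('f, 'g indet list \<Rightarrow>\<^sub>0 'f) module"
  show "field (class_ring :: 'f ring)" by (rule class_field)
  show "\<forall>v w. v \<in> carrier ?V \<and> w \<in> carrier ?V \<longrightarrow> v \<oplus>\<^bsub>?V\<^esub> w \<in> carrier ?V"
    using Poly_Mapping.keys_add unfolding free_star_algebra_def by fastforce
  show "\<forall>v\<in>carrier ?V. \<exists>neg_v\<in>carrier ?V. v \<oplus>\<^bsub>?V\<^esub> neg_v = \<zero>\<^bsub>?V\<^esub>"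
    by (rule ballI, rule_tac x = "- v" in bexI) (auto simp: free_star_algebra_def)
  show "\<forall>c v. c \<in> carrier class_ring \<and> v \<in> carrier ?V \<longrightarrow> c \<odot>\<^bsub>?V\<^esub> v \<in> carrier ?V"
    by (auto simp: free_star_algebra_def in_keys_iff)
qed (auto simp: free_star_algebra_def algebra_simps intro!: poly_mapping_eqI simp: lookup_add)

abbreviation indet_index :: "'g indet \<Rightarrow> nat" where
  "indet_index \<equiv> un_Indet1"

abbreviation indet_starred :: "'g indet \<Rightarrow> bool" where
  "indet_starred \<equiv> un_Indet3"

definition multilinear_words :: "'g set \<Rightarrow> nat \<Rightarrow> 'g indet list set" where
  "multilinear_words G n = {w. distinct (map indet_index w) \<and> indet_index ` set w = {1..n}
     \<and> (\<forall>x\<in>set w. indet_deg x \<in> G)}"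

lemma multilinear_words_conv:
  "multilinear_words G n = {map (\<lambda>k. Indet (\<sigma> k) (g k) (\<delta> k)) [1..<Suc n] | \<sigma> g \<delta>.
        \<sigma> permutes {1..n} \<and> (\<forall>k \<in> {1..n}. g k \<in> G)}"
proof (intro equalityI subsetI)
  fix w :: "'a indet list" assume w: "w \<in> multilinear_words G n"
  then have dist: "distinct (map indet_index w)" and set_w: "set (map indet_index w) = {1..n}"
    by (auto simp: multilinear_words_def)
  have len: "length w = n" using distinct_card[OF dist] set_w by simp
  \<comment> \<open>\<open>permutes\<close> demands the identity outside \<open>{1..n}\<close>; the
    shift is there because list positions start at 0.\<close>
  define \<sigma> where "\<sigma> k = (if k \<in> {1..n} then indet_index (w ! (k - 1)) else k)" for k
  have "bij_betw (\<lambda>k. map indet_index w ! (k - 1)) {1..n} {1..n}"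
  proof -
    have "bij_betw (\<lambda>k::nat. k - 1) {1..n} {..<n}"
      by (rule bij_betw_byWitness[where f' = Suc]) auto
    moreover have "bij_betw (\<lambda>k. map indet_index w ! k) {..<n} {1..n}"
      using bij_betw_nth[OF dist, of "{..<n}" "{1..n}"] len set_w by simp
    ultimately show ?thesis using bij_betw_trans by (fastforce simp: comp_def)
  qed
  then have "bij_betw \<sigma> {1..n} {1..n}"
    by (rule bij_betw_cong[THEN iffD1, rotated]) (auto simp: \<sigma>_def len)
  then have "\<sigma> permutes {1..n}" by (rule bij_imp_permutes) (auto simp: \<sigma>_def)
  moreover have "w = map (\<lambda>k. Indet (\<sigma> k) (indet_deg (w ! (k - 1))) (indet_starred (w ! (k - 1)))) [1..<Suc n]"
  proof (rule nth_equalityI)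
    fix i assume "i < length w"
    then show "w ! i = map (\<lambda>k. Indet (\<sigma> k) (indet_deg (w ! (k - 1))) (indet_starred (w ! (k - 1)))) [1..<Suc n] ! i"
      using len by (cases "w ! i") (simp add: \<sigma>_def del: upt_Suc)
  qed (simp add: len)
  moreover have "\<forall>k\<in>{1..n}. indet_deg (w ! (k - 1)) \<in> G"
    using w len by (auto simp: multilinear_words_def)
  ultimately show "w \<in> {map (\<lambda>k. Indet (\<sigma> k) (g k) (\<delta> k)) [1..<Suc n] | \<sigma> g \<delta>.
        \<sigma> permutes {1..n} \<and> (\<forall>k \<in> {1..n}. g k \<in> G)}"
    by (intro CollectI exI conjI)
next
  fix w :: "'a indet list" assume "w \<in> {map (\<lambda>k. Indet (\<sigma> k) (g k) (\<delta> k)) [1..<Suc n] | \<sigma> g \<delta>.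
        \<sigma> permutes {1..n} \<and> (\<forall>k \<in> {1..n}. g k \<in> G)}"
  then obtain \<sigma> g \<delta> where w: "w = map (\<lambda>k. Indet (\<sigma> k) (g k) (\<delta> k)) [1..<Suc n]"
    and \<sigma>: "\<sigma> permutes {1..n}" and g: "\<forall>k \<in> {1..n}. g k \<in> G" by auto
  have idx: "map indet_index w = map \<sigma> [1..<Suc n]" by (simp add: w del: upt_Suc)
  have set_upt: "set [1..<Suc n] = {1..n}" by auto
  have "distinct (map indet_index w)"
    unfolding idx distinct_map using permutes_inj_on[OF \<sigma>] by simp
  moreover have "indet_index ` set w = \<sigma> ` set [1..<Suc n]"
    by (metis idx list.set_map)
  then have "indet_index ` set w = {1..n}" by (simp only: set_upt permutes_image[OF \<sigma>])
  moreover have "\<forall>x\<in>set w. indet_deg x \<in> G" using g by (auto simp: w)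
  ultimately show "w \<in> multilinear_words G n" by (simp add: multilinear_words_def)
qed

text \<open>The polynomials supported on a fixed set of words form a subspace, and each of them is
  the sum of its scaled words.\<close>

lemma multilinear_polys_conv:
  "(multilinear_polys G n :: ('g indet list \<Rightarrow>\<^sub>0 'f::field) set)
     = {f. Poly_Mapping.keys f \<subseteq> multilinear_words G n}"
proof -
  let ?V = "free_star_algebra G :: ('f, 'g indet list \<Rightarrow>\<^sub>0 'f) module"
  let ?M = "(\<lambda>w. Poly_Mapping.single w (1::'f)) ` multilinear_words G n"
  let ?P = "{f :: 'g indet list \<Rightarrow>\<^sub>0 'f. Poly_Mapping.keys f \<subseteq> multilinear_words G n}"
  interpret V: vectorspace "class_ring :: 'f ring" ?V by (rule vectorspace_free_star_algebra)
  have M: "?M \<subseteq> carrier ?V" by (auto simp: free_star_algebra_def multilinear_words_def)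
  have span: "multilinear_polys G n = V.span ?M"
    unfolding multilinear_polys_def multilinear_words_conv
    by (rule arg_cong[where f = V.span]) (auto simp: image_iff)
  have sub: "submodule class_ring (V.span ?M) ?V" using M by (rule V.span_is_submodule)
  have "V.span ?M \<subseteq> ?P"
  proof (rule V.span_is_subset)
    show "submodule class_ring ?P ?V"
    proof (rule submodule.intro)
      show "Module.module class_ring ?V" by (rule V.module_axioms)
    next
      show "?P \<subseteq> carrier ?V" by (auto simp: free_star_algebra_def multilinear_words_def)
    next
      fix v w assume "v \<in> ?P" "w \<in> ?P"
      then show "v \<oplus>\<^bsub>?V\<^esub> w \<in> ?P"
        using Poly_Mapping.keys_add[of v w] by (auto simp: free_star_algebra_def)
    qed (auto simp: free_star_algebra_def in_keys_iff)
    show "?M \<subseteq> ?P" by auto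
  qed
  moreover have "f \<in> V.span ?M" if "f \<in> ?P" for f
  proof -
    have single: "Poly_Mapping.single w c \<in> V.span ?M" if "w \<in> multilinear_words G n" for w c
    proof -
      have "Poly_Mapping.single w 1 \<in> V.span ?M" using V.in_own_span[OF M] that by blast
      then have "c \<odot>\<^bsub>?V\<^esub> Poly_Mapping.single w 1 \<in> V.span ?M"
        using submodule.smult_closed[OF sub] by simp
      moreover have "c \<odot>\<^bsub>?V\<^esub> Poly_Mapping.single w 1 = Poly_Mapping.single w c"
        by (rule poly_mapping_eqI) (simp add: free_star_algebra_def lookup_single when_def)
      ultimately show ?thesis by simp
    qed
    have sum: "(\<Sum>w\<in>A. Poly_Mapping.single w (c w)) \<in> V.span ?M"
      if "finite A" "A \<subseteq> multilinear_words G n" for A c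
      using that
    proof (induction A rule: finite_induct)
      case empty
      then show ?case using submodule.zero_closed[OF sub] by (simp add: free_star_algebra_def)
    next
      case (insert w A)
      then show ?case using submodule.m_closed[OF sub single] by (simp add: free_star_algebra_def)
    qed
    have f: "f = (\<Sum>w\<in>Poly_Mapping.keys f. Poly_Mapping.single w (Poly_Mapping.lookup f w))"
      by (rule poly_mapping_eqI) (auto simp: lookup_sum lookup_single when_def in_keys_iff)
    show ?thesis
      using that by (subst f, intro sum) auto
  qed
  ultimately show ?thesis unfolding span by blast
qed


section \<open>Evaluation on elementary matrices\<close>

lemma UT_simps:
  "A \<in> carrier (UT ty m) \<longleftrightarrow> A \<in> carrier_mat m m \<and> (\<forall>i<m. \<forall>j<i. A $$ (i, j) = 0)"
  "mult (UT ty m) = (*)" "one (UT ty m) = 1\<^sub>m m" "zero (UT ty m) = 0\<^sub>m m m"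
  "add (UT ty m) = (+)" "smult (UT ty m) = (\<cdot>\<^sub>m)"
  by (auto simp: UT_def module_mat_simps upper_triangular_def)

lemma UT_dim: "A \<in> carrier (UT ty m) \<Longrightarrow> dim_row A = m" "A \<in> carrier (UT ty m) \<Longrightarrow> dim_col A = m"
  by (auto simp: UT_simps)

lemma vectorspace_UT: "vectorspace (class_ring :: 'f::field ring) (UT (ty :: 'f itself) m)"
proof (rule vs_criteria)
  show "field (class_ring :: 'f ring)" by (rule class_field)
  show "\<forall>v\<in>carrier (UT ty m). \<exists>neg_v\<in>carrier (UT ty m). v \<oplus>\<^bsub>UT ty m\<^esub> neg_v = \<zero>\<^bsub>UT ty m\<^esub>"
    by (rule ballI, rule_tac x = "- v" in bexI) (auto simp: UT_simps)
qed (auto simp: UT_simps algebra_simps intro!: eq_matI)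

section \<open>Index pairs of elementary matrices, their degrees and reflections\<close>

definition pairs :: "nat \<Rightarrow> (nat \<times> nat) set" where
  "pairs m = {(i, j). i \<le> j \<and> j < m}"

lemma finite_pairs [simp]: "finite (pairs m)"
  by (rule finite_subset[of _ "{..<m} \<times> {..<m}"]) (auto simp: pairs_def)

definition pair_deg :: "'g::minus list \<Rightarrow> nat \<times> nat \<Rightarrow> 'g" where
  "pair_deg gs p = gs ! fst p - gs ! snd p"

text \<open>The action of \<open>reflection\<close> on the indices of elementary matrices, applied
  only if the star flag \<open>s\<close> of a letter is set.\<close>

definition reflect :: "nat \<Rightarrow> bool \<Rightarrow> nat \<times> nat \<Rightarrow> nat \<times> nat" where
  "reflect m s p = (if s then (m - 1 - snd p, m - 1 - fst p) else p)"

lemma reflect_in_pairs [simp]: "p \<in> pairs m \<Longrightarrow> reflect m s p \<in> pairs m"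
  by (auto simp: reflect_def pairs_def)

lemma reflect_reflect [simp]: "fst p < m \<Longrightarrow> snd p < m \<Longrightarrow> reflect m s (reflect m s p) = p"
  by (auto simp: reflect_def prod_eq_iff)

text \<open>\<open>hits m gs t w k l\<close> says that the matrix product \<open>w\<close> has entry 1 (and not 0) at \<open>(k, l)\<close> if
  \<open>x\<^sub>i\<^sub>,\<^sub>g\<close> is replaced by the elementary matrix with index \<open>t i\<close> if that has degree \<open>g\<close>, and by 0
  otherwise.\<close>

fun hits :: "nat \<Rightarrow> 'g::minus list \<Rightarrow> (nat \<Rightarrow> nat \<times> nat) \<Rightarrow> 'g indet list \<Rightarrow> nat \<Rightarrow> nat \<Rightarrow> bool" where
  "hits m gs t [] k l \<longleftrightarrow> k = l"
| "hits m gs t (Indet i g s # w) k l \<longleftrightarrow> pair_deg gs (t i) = g \<and> fst (reflect m s (t i)) = k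
     \<and> hits m gs t w (snd (reflect m s (t i))) l"

lemma hits_fun_upd: "i \<notin> indet_index ` set w \<Longrightarrow> hits m gs (t(i := p)) w k l = hits m gs t w k l"
  by (induction m gs t w k l rule: hits.induct) auto

section \<open>Homogeneous components\<close>

text \<open>The right-hand side is a submodule that contains the generators of the
  component.\<close>

lemma elementary_component_subset:
  fixes ty :: "'f::field itself"
  shows "elementary_component ty m gs g \<subseteq>
    {A \<in> carrier (UT ty m). \<forall>p\<in>pairs m. pair_deg gs p \<noteq> g \<longrightarrow> A $$ p = 0}" (is "_ \<subseteq> ?N")
proof -
  interpret V: vectorspace "class_ring :: 'f ring" "UT ty m" by (rule vectorspace_UT)
  show ?thesis
    unfolding elementary_component_def
  proof (rule V.span_is_subset)
    show "submodule class_ring ?N (UT ty m)"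
    proof (rule submodule.intro)
      show "Module.module class_ring (UT ty m)" by (rule V.module_axioms)
    qed (auto simp: UT_simps pairs_def)
  qed (auto simp: UT_simps pairs_def pair_deg_def elem_mat_def)
qed

lemma elem_mat_in_component:
  fixes ty :: "'f::field itself"
  assumes "p \<in> pairs m"
  shows "elem_mat m (fst p) (snd p) \<in> elementary_component ty m gs (pair_deg gs p)"
proof -
  interpret V: vectorspace "class_ring :: 'f ring" "UT ty m" by (rule vectorspace_UT)
  let ?S = "{elem_mat m i j | i j. i \<le> j \<and> j < m \<and> gs ! i - gs ! j = pair_deg gs p} :: 'f mat set"
  have "?S \<subseteq> carrier (UT ty m)" by (auto simp: UT_simps elem_mat_def)
  moreover have "elem_mat m (fst p) (snd p) \<in> ?S" 
    using assms by (intro CollectI exI[of _ "fst p"] exI[of _ "snd p"]) (auto simp: pairs_def pair_deg_def)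
  ultimately show ?thesis unfolding elementary_component_def using V.in_own_span by blast
qed

lemma zero_in_component:
  fixes ty :: "'f::field itself"
  shows "0\<^sub>m m m \<in> elementary_component ty m gs g"
proof -
  interpret V: vectorspace "class_ring :: 'f ring" "UT ty m" by (rule vectorspace_UT)
  let ?S = "{elem_mat m i j | i j. i \<le> j \<and> j < m \<and> gs ! i - gs ! j = g} :: 'f mat set"
  have "?S \<subseteq> carrier (UT ty m)" by (auto simp: UT_simps elem_mat_def)
  from submodule.zero_closed[OF V.span_is_submodule[OF this]] show ?thesis
    by (simp add: elementary_component_def UT_simps)
qed

lemma reflection_in_UT: "A \<in> carrier (UT ty m) \<Longrightarrow> reflection m A \<in> carrier (UT ty m)"
  by (auto simp: UT_simps reflection_def)

lemma mult_in_UT: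
  assumes "A \<in> carrier (UT ty m)" "B \<in> carrier (UT ty m)"
  shows "A * B \<in> carrier (UT ty m)"
proof -
  have "(A * B) $$ (i, j) = 0" if "i < m" "j < i" for i j
  proof -
    have "A $$ (i, r) * B $$ (r, j) = 0" if "r < m" for r
      using assms \<open>i < m\<close> \<open>j < i\<close> that by (cases "r < i") (auto simp: UT_simps)
    then have "(\<Sum>r = 0..<m. A $$ (i, r) * B $$ (r, j)) = 0" by (intro sum.neutral) simp
    then show ?thesis
      using that assms[THEN UT_dim(1)] assms[THEN UT_dim(2)] by (simp add: scalar_prod_def)
  qed
  then show ?thesis using assms by (auto simp: UT_simps)
qed

section \<open>Values of words under graded substitutions\<close>

definition graded_subst ::
    "'f::field itself \<Rightarrow> nat \<Rightarrow> 'g::minus list \<Rightarrow> 'g set \<Rightarrow> (nat \<Rightarrow> 'g \<Rightarrow> 'f mat) \<Rightarrow> bool" where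
  "graded_subst ty m gs G a \<longleftrightarrow> (\<forall>i. \<forall>g\<in>G. a i g \<in> elementary_component ty m gs g)"

text \<open>At most one summand is nonzero, the one for the reflection of \<open>(k, j)\<close>. The
  sum over all pairs prepares for multiplying out words, and the coefficient
  \<open>a i (pair_deg gs p) $$ p\<close> depends only on \<open>i\<close> and \<open>p\<close>, not
  on the degree of the letter.\<close>

lemma subst_indet_entry:
  fixes a :: "nat \<Rightarrow> 'g::minus \<Rightarrow> 'f::field mat"
  assumes a: "a i g \<in> elementary_component ty m gs g" and kj: "k < m" "j < m"
  shows "subst_indet (reflection m) a (Indet i g s) $$ (k, j) =
    (\<Sum>p\<in>pairs m. (if pair_deg gs p = g \<and> reflect m s p = (k, j) then a i (pair_deg gs p) $$ p else 0))"
proof -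
  have ut: "a i g \<in> carrier (UT ty m)" and z: "\<And>p. p \<in> pairs m \<Longrightarrow> pair_deg gs p \<noteq> g \<Longrightarrow> a i g $$ p = 0"
    using a elementary_component_subset by blast+
  let ?q = "reflect m s (k, j)"
  have "reflect m s p = (k, j) \<longleftrightarrow> p = ?q" if "p \<in> pairs m" for p
  proof
    assume "reflect m s p = (k, j)"
    then show "p = ?q" using reflect_reflect[of p m s] that by (auto simp: pairs_def)
  next
    assume "p = ?q"
    then show "reflect m s p = (k, j)" using kj by (simp only: reflect_reflect fst_conv snd_conv)
  qed
  then have "(\<Sum>p\<in>pairs m. (if pair_deg gs p = g \<and> reflect m s p = (k, j) then a i (pair_deg gs p) $$ p else 0))
     = (\<Sum>p\<in>pairs m. if p = ?q then a i g $$ p else 0)"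
  proof (intro sum.cong refl)
    fix p assume "p \<in> pairs m" and eq: "\<And>p. p \<in> pairs m \<Longrightarrow> reflect m s p = (k, j) \<longleftrightarrow> p = ?q"
    then show "(if pair_deg gs p = g \<and> reflect m s p = (k, j) then a i (pair_deg gs p) $$ p else 0)
      = (if p = ?q then a i g $$ p else 0)"
      using z[of p] by (cases "pair_deg gs p = g") (simp_all only: if_True if_False simp_thms if_cancel)
  qed
  also have "\<dots> = (if ?q \<in> pairs m then a i g $$ ?q else 0)" by simp
  also have "\<dots> = subst_indet (reflection m) a (Indet i g s) $$ (k, j)"
    using ut kj by (auto simp: reflection_def reflect_def pairs_def UT_simps)
  finally show ?thesis ..
qed

lemma subst_word_in_UT:
  assumes "graded_subst ty m gs G a" "\<forall>x\<in>set w. indet_deg x \<in> G"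
  shows "subst_word (UT ty m) (reflection m) a w \<in> carrier (UT ty m)"
  using assms(2)
proof (induction w)
  case Nil
  then show ?case by (simp add: subst_word_def UT_simps)
next
  case (Cons x w)
  obtain i g s where x: "x = Indet i g s" by (cases x)
  have "a i g \<in> elementary_component ty m gs g" using assms(1) Cons.prems x by (auto simp: graded_subst_def)
  then have "a i g \<in> carrier (UT ty m)" using elementary_component_subset by blast
  then have "subst_indet (reflection m) a x \<in> carrier (UT ty m)" by (simp add: x reflection_in_UT)
  then show ?case using Cons mult_in_UT by (simp add: subst_word_def UT_simps)
qed

text \<open>Every factor is expanded in elementary matrices and the product is multiplied out. No
  variable is repeated, so a choice of one matrix per letter is a function \<open>t\<close> on the
  indices; since the field is commutative, its coefficient does not depend on the order of the
  letters.\<close>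

lemma subst_word_entry:
  fixes a :: "nat \<Rightarrow> 'g::minus \<Rightarrow> 'f::field mat"
  assumes a: "graded_subst ty m gs G a" and w: "\<forall>x\<in>set w. indet_deg x \<in> G"
    and dist: "distinct (map indet_index w)" and kl: "k < m" "l < m"
  shows "subst_word (UT ty m) (reflection m) a w $$ (k, l) =
    (\<Sum>t\<in>indet_index ` set w \<rightarrow>\<^sub>E pairs m.
       (\<Prod>i\<in>indet_index ` set w. a i (pair_deg gs (t i)) $$ t i) * of_bool (hits m gs t w k l))"
  using w dist kl(1)
proof (induction w arbitrary: k)
  case Nil
  then show ?case using kl by (simp add: subst_word_def UT_simps PiE_empty_domain)
next
  case (Cons x w)
  obtain i g s where x: "x = Indet i g s" by (cases x)
  let ?I = "indet_index ` set w"
  let ?b = "\<lambda>i p. a i (pair_deg gs p) $$ p"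
  let ?X = "subst_indet (reflection m) a x" and ?W = "subst_word (UT ty m) (reflection m) a w"
  have i: "i \<notin> ?I" using Cons.prems x by auto
  have aig: "a i g \<in> elementary_component ty m gs g" using a Cons.prems x by (auto simp: graded_subst_def)
  have "?X \<in> carrier (UT ty m)"
    using aig elementary_component_subset[of ty m gs g] by (auto simp: x reflection_in_UT)
  moreover have "?W \<in> carrier (UT ty m)" using Cons.prems by (intro subst_word_in_UT[OF a]) simp
  ultimately have dims: "?X \<in> carrier_mat m m" "?W \<in> carrier_mat m m" by (auto simp: UT_simps)
  have IH: "?W $$ (j, l) = (\<Sum>t\<in>?I \<rightarrow>\<^sub>E pairs m. (\<Prod>i\<in>?I. ?b i (t i)) * of_bool (hits m gs t w j l))"
    if "j < m" for j using Cons.IH[OF _ _ that] Cons.prems by simp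
  have "subst_word (UT ty m) (reflection m) a (x # w) $$ (k, l) = (?X * ?W) $$ (k, l)"
    by (simp add: subst_word_def UT_simps)
  also have "\<dots> = (\<Sum>j<m. ?X $$ (k, j) * ?W $$ (j, l))"
    using dims Cons.prems(3) kl by (simp add: scalar_prod_def atLeast0LessThan)
  also have "\<dots> = (\<Sum>j<m. \<Sum>p\<in>pairs m.
      (if pair_deg gs p = g \<and> reflect m s p = (k, j) then ?b i p else 0) * ?W $$ (j, l))"
    using subst_indet_entry[where a = a and i = i and g = g, OF aig Cons.prems(3)] by (simp add: x sum_distrib_right)
  also have "\<dots> = (\<Sum>p\<in>pairs m. \<Sum>j<m.
      (if pair_deg gs p = g \<and> reflect m s p = (k, j) then ?b i p else 0) * ?W $$ (j, l))"
    by (rule sum.swap)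
  \<comment> \<open>For a given \<open>p\<close>, only the column \<open>j\<close> in which the
    reflected pair ends survives.\<close>
  also have "\<dots> = (\<Sum>p\<in>pairs m. of_bool (pair_deg gs p = g \<and> fst (reflect m s p) = k) * ?b i p
      * ?W $$ (snd (reflect m s p), l))"
  proof (rule sum.cong[OF refl])
    fix p assume "p \<in> pairs m"
    then have "snd (reflect m s p) < m" using reflect_in_pairs[of p m s] by (auto simp: pairs_def)
    moreover have "(if pair_deg gs p = g \<and> reflect m s p = (k, j) then ?b i p else 0) * ?W $$ (j, l)
      = (if j = snd (reflect m s p) then
          of_bool (pair_deg gs p = g \<and> fst (reflect m s p) = k) * ?b i p * ?W $$ (j, l) else 0)" for j
      by (auto simp: prod_eq_iff)
    ultimately show "(\<Sum>j<m. (if pair_deg gs p = g \<and> reflect m s p = (k, j) then ?b i p else 0) * ?W $$ (j, l))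
      = of_bool (pair_deg gs p = g \<and> fst (reflect m s p) = k) * ?b i p * ?W $$ (snd (reflect m s p), l)"
      by simp
  qed
  \<comment> \<open>The index \<open>i\<close> does not occur in \<open>w\<close>, so changing
    \<open>t\<close> at \<open>i\<close> does not affect whether \<open>w\<close> hits.\<close>
  also have "\<dots> = (\<Sum>p\<in>pairs m. \<Sum>t\<in>?I \<rightarrow>\<^sub>E pairs m.
      ?b i p * (\<Prod>i\<in>?I. ?b i (t i)) * of_bool (hits m gs (t(i := p)) (x # w) k l))"
  proof (rule sum.cong[OF refl])
    fix p assume "p \<in> pairs m"
    then have "snd (reflect m s p) < m" using reflect_in_pairs[of p m s] by (auto simp: pairs_def)
    from IH[OF this] show "of_bool (pair_deg gs p = g \<and> fst (reflect m s p) = k) * ?b i p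
      * ?W $$ (snd (reflect m s p), l) = (\<Sum>t\<in>?I \<rightarrow>\<^sub>E pairs m.
      ?b i p * (\<Prod>i\<in>?I. ?b i (t i)) * of_bool (hits m gs (t(i := p)) (x # w) k l))"
      by (auto simp: x hits_fun_upd[OF i] sum_distrib_left intro!: sum.cong)
  qed
  also have "\<dots> = (\<Sum>(p, t)\<in>pairs m \<times> (?I \<rightarrow>\<^sub>E pairs m).
      ?b i p * (\<Prod>i\<in>?I. ?b i (t i)) * of_bool (hits m gs (t(i := p)) (x # w) k l))"
    by (rule sum.cartesian_product)
  also have "\<dots> = (\<Sum>(p, t)\<in>pairs m \<times> (?I \<rightarrow>\<^sub>E pairs m).
      (\<Prod>i'\<in>insert i ?I. ?b i' ((t(i := p)) i')) * of_bool (hits m gs (t(i := p)) (x # w) k l))"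
  proof (rule sum.cong[OF refl], clarify)
    fix p1 p2 t
    have "(\<Prod>i'\<in>?I. ?b i' ((t(i := (p1, p2))) i')) = (\<Prod>i'\<in>?I. ?b i' (t i'))"
      using i by (intro prod.cong) auto
    then show "?b i (p1, p2) * (\<Prod>i\<in>?I. ?b i (t i)) * of_bool (hits m gs (t(i := (p1, p2))) (x # w) k l)
      = (\<Prod>i'\<in>insert i ?I. ?b i' ((t(i := (p1, p2))) i')) * of_bool (hits m gs (t(i := (p1, p2))) (x # w) k l)"
      using i by (subst prod.insert) auto
  qed
  \<comment> \<open>A function on \<open>insert i ?I\<close> amounts to its value at
    \<open>i\<close> and a function on \<open>?I\<close>.\<close>
  also have "\<dots> = (\<Sum>t\<in>insert i ?I \<rightarrow>\<^sub>E pairs m.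
      (\<Prod>i'\<in>insert i ?I. ?b i' (t i')) * of_bool (hits m gs t (x # w) k l))"
    unfolding PiE_insert_eq
    by (subst sum.reindex[OF inj_combinator[OF i]]) (auto intro!: sum.cong)
  finally show ?case by (simp add: x)
qed

section \<open>Tests and identities\<close>

text \<open>The entry \<open>(k, l)\<close> of the value of \<open>f\<close> when the variable with
  index \<open>i\<close> and degree \<open>g\<close> is replaced by the elementary matrix with index
  \<open>t i\<close>, or by 0 if that has another degree.\<close>

definition test_value ::
    "nat \<Rightarrow> 'g::minus list \<Rightarrow> ('g indet list \<Rightarrow>\<^sub>0 'f::field) \<Rightarrow> (nat \<Rightarrow> nat \<times> nat) \<times> nat \<times> nat \<Rightarrow> 'f" where
  "test_value m gs f = (\<lambda>(t, k, l).
     \<Sum>w\<in>Poly_Mapping.keys f. Poly_Mapping.lookup f w * of_bool (hits m gs t w k l))"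

lemma UT_finsum_closed:
  fixes ty :: "'f::field itself"
  assumes "\<And>x. x \<in> A \<Longrightarrow> M x \<in> carrier (UT ty m)"
  shows "(\<Oplus>\<^bsub>UT ty m\<^esub> x\<in>A. M x) \<in> carrier (UT ty m)"
proof -
  interpret V: vectorspace "class_ring :: 'f ring" "UT ty m" by (rule vectorspace_UT)
  show ?thesis using assms by (intro V.finsum_closed) auto
qed

lemma UT_finsum_entry:
  fixes ty :: "'f::field itself"
  assumes "finite A" "\<And>x. x \<in> A \<Longrightarrow> M x \<in> carrier (UT ty m)" "k < m" "l < m"
  shows "(\<Oplus>\<^bsub>UT ty m\<^esub> x\<in>A. M x) $$ (k, l) = (\<Sum>x\<in>A. M x $$ (k, l))"
  using assms(1,2)
proof (induction A rule: finite_induct)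
  case empty
  interpret V: vectorspace "class_ring :: 'f ring" "UT ty m" by (rule vectorspace_UT)
  show ?case using assms by (simp add: UT_simps)
next
  case (insert x A)
  interpret V: vectorspace "class_ring :: 'f ring" "UT ty m" by (rule vectorspace_UT)
  have "(\<Oplus>\<^bsub>UT ty m\<^esub> x\<in>insert x A. M x) = M x \<oplus>\<^bsub>UT ty m\<^esub> (\<Oplus>\<^bsub>UT ty m\<^esub> x\<in>A. M x)"
    using insert by (intro V.finsum_insert) auto
  moreover have sum: "(\<Oplus>\<^bsub>UT ty m\<^esub> x\<in>A. M x) \<in> carrier (UT ty m)" using insert by (intro UT_finsum_closed) auto
  ultimately show ?case
    using insert assms(3,4) UT_dim[OF sum] by (simp add: UT_simps(2-))
qed

lemma smult_in_UT: "A \<in> carrier (UT ty m) \<Longrightarrow> c \<odot>\<^bsub>UT ty m\<^esub> A \<in> carrier (UT ty m)"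
  by (auto simp: UT_simps)

lemma subst_poly_in_UT:
  assumes f: "f \<in> multilinear_polys G n" and a: "graded_subst ty m gs G a"
  shows "subst_poly (UT ty m) (reflection m) a f \<in> carrier (UT ty m)"
  unfolding subst_poly_def using f
  by (intro UT_finsum_closed smult_in_UT subst_word_in_UT[OF a])
    (auto simp: multilinear_polys_conv multilinear_words_def)

text \<open>The coefficient of \<open>test_value m gs f (t, k, l)\<close> does not depend on the words of \<open>f\<close>: a word
  with other degrees than those of \<open>t\<close> does not hit.\<close>

lemma subst_poly_entry:
  fixes f :: "'g::minus indet list \<Rightarrow>\<^sub>0 'f::field" and ty :: "'f itself"
  assumes f: "f \<in> multilinear_polys G n" and a: "graded_subst ty m gs G a" and kl: "k < m" "l < m"
  shows "subst_poly (UT ty m) (reflection m) a f $$ (k, l) =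
    (\<Sum>t\<in>{1..n} \<rightarrow>\<^sub>E pairs m. (\<Prod>i\<in>{1..n}. a i (pair_deg gs (t i)) $$ t i) * test_value m gs f (t, k, l))"
proof -
  let ?b = "\<lambda>t. \<Prod>i\<in>{1..n}. a i (pair_deg gs (t i)) $$ t i"
  have keys: "Poly_Mapping.keys f \<subseteq> multilinear_words G n" using f by (simp add: multilinear_polys_conv)
  have ut: "subst_word (UT ty m) (reflection m) a w \<in> carrier (UT ty m)" if "w \<in> Poly_Mapping.keys f" for w
    using keys that by (intro subst_word_in_UT[OF a]) (auto simp: multilinear_words_def)
  have "subst_poly (UT ty m) (reflection m) a f $$ (k, l) =
    (\<Sum>w\<in>Poly_Mapping.keys f. (Poly_Mapping.lookup f w \<odot>\<^bsub>UT ty m\<^esub> subst_word (UT ty m) (reflection m) a w) $$ (k, l))"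
    unfolding subst_poly_def using ut kl by (intro UT_finsum_entry smult_in_UT) auto
  also have "\<dots> = (\<Sum>w\<in>Poly_Mapping.keys f. Poly_Mapping.lookup f w * subst_word (UT ty m) (reflection m) a w $$ (k, l))"
    using ut kl by (intro sum.cong refl) (simp add: UT_simps(2-) ut[THEN UT_dim(1)] ut[THEN UT_dim(2)])
  also have "\<dots> = (\<Sum>w\<in>Poly_Mapping.keys f. Poly_Mapping.lookup f w *
      (\<Sum>t\<in>{1..n} \<rightarrow>\<^sub>E pairs m. ?b t * of_bool (hits m gs t w k l)))"
  proof (rule sum.cong[OF refl])
    fix w assume "w \<in> Poly_Mapping.keys f"
    then have "w \<in> multilinear_words G n" using keys by auto
    then have w: "\<forall>x\<in>set w. indet_deg x \<in> G" "distinct (map indet_index w)" "indet_index ` set w = {1..n}"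
      by (auto simp: multilinear_words_def)
    show "Poly_Mapping.lookup f w * subst_word (UT ty m) (reflection m) a w $$ (k, l) = Poly_Mapping.lookup f w *
      (\<Sum>t\<in>{1..n} \<rightarrow>\<^sub>E pairs m. ?b t * of_bool (hits m gs t w k l))"
      using subst_word_entry[OF a w(1,2) kl] by (simp add: w(3))
  qed
  also have "\<dots> = (\<Sum>w\<in>Poly_Mapping.keys f. \<Sum>t\<in>{1..n} \<rightarrow>\<^sub>E pairs m.
      ?b t * (Poly_Mapping.lookup f w * of_bool (hits m gs t w k l)))"
    by (simp add: sum_distrib_left mult_ac)
  also have "\<dots> = (\<Sum>t\<in>{1..n} \<rightarrow>\<^sub>E pairs m. \<Sum>w\<in>Poly_Mapping.keys f.
      ?b t * (Poly_Mapping.lookup f w * of_bool (hits m gs t w k l)))"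
    by (rule sum.swap)
  also have "\<dots> = (\<Sum>t\<in>{1..n} \<rightarrow>\<^sub>E pairs m. ?b t * test_value m gs f (t, k, l))"
    by (simp only: test_value_def prod.case sum_distrib_left)
  finally show ?thesis .
qed

text \<open>If all test values vanish, so does the expansion in \<open>subst_poly_entry\<close>.
  Conversely, each test is itself a graded substitution, and it singles out one summand of that
  expansion.\<close>

lemma multilinear_identity_iff:
  fixes f :: "'g::minus indet list \<Rightarrow>\<^sub>0 'f::field" and ty :: "'f itself"
  assumes f: "f \<in> multilinear_polys G n" and m: "m > 0"
  shows "f \<in> star_identities (UT ty m) (reflection m) G (elementary_component ty m gs) \<longleftrightarrow>
    (\<forall>t\<in>{1..n} \<rightarrow>\<^sub>E pairs m. \<forall>k<m. \<forall>l<m. test_value m gs f (t, k, l) = 0)"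
proof
  assume id: "f \<in> star_identities (UT ty m) (reflection m) G (elementary_component ty m gs)"
  show "\<forall>t\<in>{1..n} \<rightarrow>\<^sub>E pairs m. \<forall>k<m. \<forall>l<m. test_value m gs f (t, k, l) = 0"
  proof (intro ballI allI impI)
    fix t k l assume t: "t \<in> {1..n} \<rightarrow>\<^sub>E pairs m" and kl: "k < m" "l < m"
    \<comment> \<open>The test \<open>t\<close> as a substitution: the elementary matrix in its own
      degree, 0 in all other degrees. The coefficient of \<open>u\<close> in the expansion is then 1
      for \<open>u = t\<close> and 0 otherwise.\<close>
    define a :: "nat \<Rightarrow> 'g \<Rightarrow> 'f mat" where
      "a i g = (if i \<in> {1..n} \<and> pair_deg gs (t i) = g then elem_mat m (fst (t i)) (snd (t i)) else 0\<^sub>m m m)" for i g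
    have a: "graded_subst ty m gs G a"
      using t elem_mat_in_component[of _ m ty gs] zero_in_component[of m ty gs]
      by (auto simp: graded_subst_def a_def PiE_def Pi_def)
    have ab: "a i (pair_deg gs p) $$ p = of_bool (p = t i)" if "i \<in> {1..n}" "p \<in> pairs m" for i p
      using that by (cases p; cases "t i") (auto simp: a_def elem_mat_def pairs_def)
    have "(\<Prod>i\<in>{1..n}. a i (pair_deg gs (u i)) $$ u i) = of_bool (u = t)" if u: "u \<in> {1..n} \<rightarrow>\<^sub>E pairs m" for u
    proof -
      have "(\<Prod>i\<in>{1..n}. a i (pair_deg gs (u i)) $$ u i) = (\<Prod>i\<in>{1..n}. of_bool (u i = t i))"
        using u by (intro prod.cong refl ab) auto
      also have "\<dots> = of_bool (\<forall>i\<in>{1..n}. u i = t i)" by (simp add: of_bool_def)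
      also have "(\<forall>i\<in>{1..n}. u i = t i) \<longleftrightarrow> u = t" using u t by (auto intro: PiE_ext)
      finally show ?thesis .
    qed
    then have "subst_poly (UT ty m) (reflection m) a f $$ (k, l) =
      (\<Sum>u\<in>{1..n} \<rightarrow>\<^sub>E pairs m. if u = t then test_value m gs f (u, k, l) else 0)"
      unfolding subst_poly_entry[OF f a kl] by (intro sum.cong) auto
    also have "\<dots> = test_value m gs f (t, k, l)"
      using t by (subst sum.delta) (auto intro: finite_PiE)
    finally have "test_value m gs f (t, k, l) = subst_poly (UT ty m) (reflection m) a f $$ (k, l)" ..
    also have "\<dots> = 0"
      using id a kl by (auto simp: star_identities_def graded_subst_def UT_simps)
    finally show "test_value m gs f (t, k, l) = 0" .
  qed
next
  assume test: "\<forall>t\<in>{1..n} \<rightarrow>\<^sub>E pairs m. \<forall>k<m. \<forall>l<m. test_value m gs f (t, k, l) = 0"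
  have carr: "f \<in> carrier (free_star_algebra G)"
    using f by (auto simp: multilinear_polys_conv multilinear_words_def free_star_algebra_def)
  have "subst_poly (UT ty m) (reflection m) a f = \<zero>\<^bsub>UT ty m\<^esub>" if "graded_subst ty m gs G a" for a
  proof (rule eq_matI)
    show "subst_poly (UT ty m) (reflection m) a f $$ (k, l) = \<zero>\<^bsub>UT ty m\<^esub> $$ (k, l)"
      if "k < dim_row \<zero>\<^bsub>UT ty m\<^esub>" "l < dim_col \<zero>\<^bsub>UT ty m\<^esub>" for k l
      using that test subst_poly_entry[OF f \<open>graded_subst ty m gs G a\<close>] by (simp add: UT_simps)
  qed (use subst_poly_in_UT[OF f that] in \<open>auto simp: UT_simps\<close>)
  then show "f \<in> star_identities (UT ty m) (reflection m) G (elementary_component ty m gs)"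
    using carr by (auto simp: star_identities_def graded_subst_def)
qed


section \<open>Paths\<close>

text \<open>The condition for the product of the elementary matrices with indices \<open>ps\<close>
  to have entry 1 at \<open>(k, l)\<close>; the empty product is the identity matrix.\<close>

fun chain :: "nat \<Rightarrow> nat \<Rightarrow> (nat \<times> nat) list \<Rightarrow> bool" where
  "chain k l [] \<longleftrightarrow> k = l"
| "chain k l (p # ps) \<longleftrightarrow> fst p = k \<and> chain (snd p) l ps"

abbreviation diagonal :: "nat \<times> nat \<Rightarrow> bool" where
  "diagonal p \<equiv> fst p = snd p"

text \<open>Indices never decrease along the path, and every off-diagonal step raises them by at
  least 1.\<close>

lemma chain_length:
  assumes "chain k l ps" and "\<forall>p\<in>set ps. fst p \<le> snd p"
  shows "k + length (filter (\<lambda>p. \<not> diagonal p) ps) \<le> l"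
  using assms by (induction ps arbitrary: k) force+

text \<open>The equality case of \<open>chain_length\<close>: every off-diagonal step has length
  exactly 1, so no index is skipped.\<close>

lemma chain_tight:
  assumes "chain k l ps" and "\<forall>p\<in>set ps. fst p \<le> snd p"
    and "l \<le> k + length (filter (\<lambda>p. \<not> diagonal p) ps)"
  shows "filter (\<lambda>p. \<not> diagonal p) ps = map (\<lambda>a. (a, Suc a)) [k..<l]"
  using assms
proof (induction ps arbitrary: k)
  case Nil
  then show ?case by simp
next
  case (Cons p ps)
  show ?case
  proof (cases "diagonal p")
    case True
    then show ?thesis using Cons by auto
  next
    case False
    then have lt: "fst p < snd p" using Cons.prems(2) by (simp add: order_less_le)
    have ch: "chain (snd p) l ps" "k = fst p" using Cons.prems(1) by auto
    \<comment> \<open>The later off-diagonal steps use up all but at most one unit of the distance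
      from \<open>k\<close> to \<open>l\<close>, so the length of \<open>p\<close> cannot exceed
      1.\<close>
    have "snd p + length (filter (\<lambda>p. \<not> diagonal p) ps) \<le> l"
      using chain_length[OF ch(1)] Cons.prems(2) by simp
    moreover have "l \<le> Suc k + length (filter (\<lambda>p. \<not> diagonal p) ps)"
      using Cons.prems(3) False by simp
    ultimately have snd: "snd p = Suc k" "k < l" using lt ch(2) by linarith+
    then have "filter (\<lambda>p. \<not> diagonal p) ps = map (\<lambda>a. (a, Suc a)) [Suc k..<l]"
      using Cons.IH[of "Suc k"] ch(1) Cons.prems False by simp
    moreover have "p = (k, Suc k)" using snd ch(2) by (simp add: prod_eq_iff)
    ultimately show ?thesis using False snd by (simp add: upt_conv_Cons[of k l])
  qed
qed

text \<open>The start and the pattern of diagonal pairs determine each next pair: a diagonal one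
  stays at its index, any other goes up by 1.\<close>

lemma chain_unique:
  assumes "list_all2 (\<lambda>p q. diagonal p \<longleftrightarrow> diagonal q) ps qs"
    and "chain k l ps" "chain k l' qs"
    and "\<forall>p\<in>set ps. \<not> diagonal p \<longrightarrow> snd p = Suc (fst p)"
    and "\<forall>q\<in>set qs. \<not> diagonal q \<longrightarrow> snd q = Suc (fst q)"
  shows "ps = qs"
  using assms
proof (induction arbitrary: k rule: list_all2_induct)
  case (Cons p ps q qs)
  have "fst p = k" "fst q = k" "chain (snd p) l ps" "chain (snd q) l' qs" using Cons.prems by auto
  moreover have "snd p = snd q"
    using Cons.hyps(1) Cons.prems(3,4) calculation(1,2)
    by (cases "diagonal p") auto
  ultimately show ?case using Cons.IH[of "snd p"] Cons.prems(3,4) by (auto simp: prod_eq_iff)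
qed simp

text \<open>In a sorted list of keys, the key \<open>2 * a\<close> stands for the diagonal step \<open>(a, a)\<close> and the
  key \<open>2 * a + 1\<close> for the step \<open>(a, a + 1)\<close>.\<close>

lemma chain_of_sorted:
  assumes "sorted ks" "k \<le> l" "\<forall>x\<in>set ks. 2 * k \<le> x \<and> x \<le> 2 * l"
    and "\<forall>a. k \<le> a \<and> a < l \<longrightarrow> count_list ks (2 * a + 1) = 1"
  shows "chain k l (map (\<lambda>x. (x div 2, Suc x div 2)) ks)"
  using assms
proof (induction ks arbitrary: k)
  case Nil
  \<comment> \<open>If \<open>k < l\<close>, the empty list would have to contain the key for
    \<open>a = k\<close>.\<close>
  then show ?case by (metis chain.simps(1) count_list.simps(1) list.map(1) order_le_less zero_neq_one order_refl)
next
  case (Cons x ks)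
  show ?case
  proof (cases "x = 2 * k")
    case True
    have "count_list ks (2 * a + 1) = 1" if "k \<le> a \<and> a < l" for a
    proof -
      have "x \<noteq> 2 * a + 1" using True by presburger
      then show ?thesis using Cons.prems(4) that by (metis count_list.simps(2))
    qed
    then show ?thesis using Cons True by auto
  next
    case False
    then have x: "2 * k < x" "x \<le> 2 * l" using Cons.prems(3) by force+
    have kl: "k < l" using x by simp
    \<comment> \<open>The keys are sorted, so a larger first key would leave out the required step
      \<open>(k, k + 1)\<close>.\<close>
    have x1: "x = 2 * k + 1"
    proof (rule ccontr)
      assume "x \<noteq> 2 * k + 1"
      then have "2 * k + 1 < x" using x by linarith
      then have "2 * k + 1 \<notin> set (x # ks)" using Cons.prems(1) by force
      then have "count_list (x # ks) (2 * k + 1) = 0" by (simp add: count_list_0_iff)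
      then show False using Cons.prems(4) kl by (metis order_refl zero_neq_one)
    qed
    then have "count_list ks (2 * k + 1) = 0"
      using Cons.prems(4) kl by (metis count_list.simps(2) One_nat_def Suc_inject
        order_refl add.commute plus_1_eq_Suc)
    then have notin: "2 * k + 1 \<notin> set ks" by (simp add: count_list_0_iff)
    \<comment> \<open>The only occurrence of \<open>2 * k + 1\<close> is used up, so what follows
      belongs to row \<open>k + 1\<close> or beyond.\<close>
    have ge: "2 * Suc k \<le> y" if "y \<in> set ks" for y
    proof -
      have "x \<le> y" "y \<noteq> x" using Cons.prems(1) that notin x1 by auto
      then show ?thesis using x1 by simp
    qed
    have "count_list ks (2 * a + 1) = 1" if "Suc k \<le> a \<and> a < l" for a
    proof -
      have "x \<noteq> 2 * a + 1" using x1 that by presburger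
      then show ?thesis using Cons.prems(4) that by (metis count_list.simps(2) Suc_leD)
    qed
    then have "chain (Suc k) l (map (\<lambda>x. (x div 2, Suc x div 2)) ks)"
      using Cons.IH[of "Suc k"] Cons.prems(1,3) ge kl by auto
    then show ?thesis using x1 by simp
  qed
qed

text \<open>Bijections between corresponding fibres are glued together. This serves to assign to
  each off-diagonal variable a step from its orbit.\<close>

lemma bij_betw_from_fibres:
  assumes fin: "finite A" "finite B"
    and card: "\<And>c. card {a \<in> A. f a = c} = card {b \<in> B. g b = c}"
  shows "\<exists>h. bij_betw h A B \<and> (\<forall>a\<in>A. g (h a) = f a)"
proof -
  have "\<exists>h. bij_betw h {a \<in> A. f a = c} {b \<in> B. g b = c}" for c
    using card fin by (intro finite_same_card_bij) auto
  then obtain h where h: "\<And>c. bij_betw (h c) {a \<in> A. f a = c} {b \<in> B. g b = c}" by metis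
  define H where "H a = h (f a) a" for a
  have H: "H a \<in> B" "g (H a) = f a" if "a \<in> A" for a
    using h[of "f a"] that by (auto simp: H_def bij_betw_def)
  have "bij_betw H A B"
  proof (intro bij_betw_imageI inj_onI equalityI subsetI)
    fix x y assume xy: "x \<in> A" "y \<in> A" "H x = H y"
    then have "f x = f y" using H by metis
    then show "x = y" using h[of "f x"] xy by (auto simp: H_def bij_betw_def inj_on_def)
  next
    fix b assume "b \<in> B"
    then have "b \<in> h (g b) ` {a \<in> A. f a = g b}" using h[of "g b"] by (auto simp: bij_betw_def)
    then obtain a where "a \<in> A" "b = H a" by (auto simp: H_def)
    then show "b \<in> H ` A" by blast
  qed (use H in auto)
  then show ?thesis using H by blast
qed


section \<open>Bounds for the codimensions\<close>

definition path :: "nat \<Rightarrow> (nat \<Rightarrow> nat \<times> nat) \<Rightarrow> 'g indet list \<Rightarrow> (nat \<times> nat) list" where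
  "path m t w = map (\<lambda>x. reflect m (indet_starred x) (t (indet_index x))) w"

lemma hits_iff_chain:
  "hits m gs t w k l \<longleftrightarrow> (\<forall>x\<in>set w. pair_deg gs (t (indet_index x)) = indet_deg x) \<and> chain k l (path m t w)"
  by (induction m gs t w k l rule: hits.induct) (auto simp: path_def)

lemma diagonal_reflect [simp]: "p \<in> pairs m \<Longrightarrow> diagonal (reflect m s p) \<longleftrightarrow> diagonal p"
  by (auto simp: reflect_def pairs_def)

lemma multilinear_words_index: "w \<in> multilinear_words G n \<Longrightarrow> x \<in> set w \<Longrightarrow> indet_index x \<in> {1..n}"
  by (auto simp: multilinear_words_def)

lemma path_in_pairs:
  assumes "w \<in> multilinear_words G n" "t \<in> {1..n} \<rightarrow>\<^sub>E pairs m"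
  shows "set (path m t w) \<subseteq> pairs m"
proof
  fix p assume "p \<in> set (path m t w)"
  then obtain x where x: "x \<in> set w" "p = reflect m (indet_starred x) (t (indet_index x))"
    by (auto simp: path_def)
  have "t (indet_index x) \<in> pairs m"
    using assms(2) multilinear_words_index[OF assms(1) x(1)] by (rule PiE_mem)
  then show "p \<in> pairs m" by (simp add: x(2))
qed

text \<open>Every variable occurs exactly once in \<open>w\<close>, so counting along the path is
  counting variables. The property has to be invariant under reflection because the star flags in
  \<open>w\<close> are arbitrary.\<close>

lemma length_filter_path:
  assumes w: "w \<in> multilinear_words G n"
    and P: "\<And>i s. i \<in> {1..n} \<Longrightarrow> P (reflect m s (t i)) \<longleftrightarrow> Q i"
  shows "length (filter P (path m t w)) = card {i \<in> {1..n}. Q i}"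
proof -
  have "filter (P \<circ> (\<lambda>x. reflect m (indet_starred x) (t (indet_index x)))) w = filter (Q \<circ> indet_index) w"
    using P multilinear_words_index[OF w] by (intro filter_cong) (auto simp del: atLeastAtMost_iff)
  then have "length (filter P (path m t w)) = length (filter Q (map indet_index w))"
    by (simp add: path_def filter_map)
  also have "\<dots> = card ({i. Q i} \<inter> {1..n})"
    using w by (subst distinct_length_filter) (auto simp: multilinear_words_def)
  also have "{i. Q i} \<inter> {1..n} = {i \<in> {1..n}. Q i}" by auto
  finally show ?thesis .
qed

section \<open>Orbits of steps, top tests and low tests\<close>

text \<open>\<open>fold_class m a\<close> names the orbit \<open>{a, m - 2 - a}\<close> of the step \<open>(a, a + 1)\<close> under reflection.\<close>

definition fold_class :: "nat \<Rightarrow> nat \<Rightarrow> nat" where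
  "fold_class m a = min a (m - 2 - a)"

definition step_class :: "nat \<Rightarrow> nat \<Rightarrow> (nat \<times> nat) set" where
  "step_class m c = {(a, Suc a) | a. Suc a < m \<and> fold_class m a = c}"

definition off_diagonal :: "(nat \<Rightarrow> nat \<times> nat) \<Rightarrow> nat \<Rightarrow> nat set" where
  "off_diagonal t n = {i \<in> {1..n}. \<not> diagonal (t i)}"

text \<open>A test assigns to each variable \<open>x\<^sub>i\<close> the elementary matrix with index \<open>t i\<close>. The tests in
  \<open>top_tests m n\<close> are those that can be arranged, up to reflection, to a path from row \<open>0\<close> to
  column \<open>m - 1\<close> with all \<open>m - 1\<close> steps of length 1.\<close>

definition top_tests :: "nat \<Rightarrow> nat \<Rightarrow> (nat \<Rightarrow> nat \<times> nat) set" where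
  "top_tests m n = {t \<in> {1..n} \<rightarrow>\<^sub>E ((\<lambda>a. (a, a)) ` {..<m} \<union> (\<Union>c<m div 2. step_class m c)).
     \<forall>c<m div 2. card {i \<in> {1..n}. t i \<in> step_class m c} = card (step_class m c)}"

text \<open>The inequality avoids truncated subtraction, so that there are no low tests for
  \<open>m = 1\<close>.\<close>

definition low_tests :: "nat \<Rightarrow> nat \<Rightarrow> (nat \<Rightarrow> nat \<times> nat) set" where
  "low_tests m n = {t \<in> {1..n} \<rightarrow>\<^sub>E pairs m. card (off_diagonal t n) + 2 \<le> m}"

lemma fold_class_less: "Suc a < m \<Longrightarrow> fold_class m a < m div 2"
  by (auto simp: fold_class_def min_def)

lemma step_class_subset: "step_class m c \<subseteq> pairs m"
  by (auto simp: step_class_def pairs_def)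

text \<open>Reflection sends the step from \<open>a\<close> to the step from
  \<open>m - 2 - a\<close>, which has the same \<open>fold_class\<close>. The converse follows
  because reflection is an involution.\<close>

lemma step_class_reflect [simp]:
  assumes "p \<in> pairs m"
  shows "reflect m s p \<in> step_class m c \<longleftrightarrow> p \<in> step_class m c"
proof -
  have *: "reflect m s q \<in> step_class m c" if "q \<in> step_class m c" for q
  proof (cases s)
    case True
    from that obtain a where a: "q = (a, Suc a)" "Suc a < m" "fold_class m a = c"
      by (auto simp: step_class_def)
    have "reflect m s q = (m - 2 - a, Suc (m - 2 - a))" using a True by (auto simp: reflect_def)
    moreover have "fold_class m (m - 2 - a) = c" using a by (auto simp: fold_class_def)
    ultimately show ?thesis using a by (auto simp: step_class_def)
  qed (use that in \<open>auto simp: reflect_def\<close>)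
  have "reflect m s (reflect m s p) = p" using assms by (intro reflect_reflect) (auto simp: pairs_def)
  then show ?thesis using * by metis
qed

lemma card_step_class: "card (step_class m c) = card {a. Suc a < m \<and> fold_class m a = c}"
proof -
  have "step_class m c = (\<lambda>a. (a, Suc a)) ` {a. Suc a < m \<and> fold_class m a = c}"
    by (auto simp: step_class_def)
  then show ?thesis by (simp add: card_image inj_on_def)
qed

lemma top_tests_subset: "top_tests m n \<subseteq> {1..n} \<rightarrow>\<^sub>E pairs m"
proof -
  have "(\<lambda>a. (a, a)) ` {..<m} \<union> (\<Union>c<m div 2. step_class m c) \<subseteq> pairs m"
    using step_class_subset by (auto simp: pairs_def)
  then have "({1..n} \<rightarrow>\<^sub>E ((\<lambda>a. (a, a)) ` {..<m} \<union> (\<Union>c<m div 2. step_class m c))) \<subseteq> ({1..n} \<rightarrow>\<^sub>E pairs m)"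
    by (intro PiE_mono) auto
  then show ?thesis by (auto simp: top_tests_def)
qed

lemma chain_in_pairs: "chain k l ps \<Longrightarrow> set ps \<subseteq> pairs m \<Longrightarrow> k + length (filter (\<lambda>p. \<not> diagonal p) ps) \<le> l"
  by (rule chain_length) (auto simp: pairs_def)

section \<open>Which words hit which tests\<close>

text \<open>With at least \<open>m - 1\<close> off-diagonal variables, \<open>chain_length\<close>
  leaves no slack among the \<open>m\<close> indices, so \<open>chain_tight\<close> applies.\<close>

lemma tight_path:
  assumes w: "w \<in> multilinear_words G n" and t: "t \<in> {1..n} \<rightarrow>\<^sub>E pairs m"
    and hit: "hits m gs t w k l" and l: "l < m" and off: "m \<le> Suc (card (off_diagonal t n))"
  shows "k = 0" "l = m - 1" "filter (\<lambda>p. \<not> diagonal p) (path m t w) = map (\<lambda>a. (a, Suc a)) [0..<m - 1]"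
    "card (off_diagonal t n) = m - 1"
proof -
  have ch: "chain k l (path m t w)" using hit by (simp add: hits_iff_chain)
  have sub: "set (path m t w) \<subseteq> pairs m" using w t by (rule path_in_pairs)
  have len: "length (filter (\<lambda>p. \<not> diagonal p) (path m t w)) = card (off_diagonal t n)"
    unfolding off_diagonal_def
    by (rule length_filter_path[OF w], subst diagonal_reflect) (rule PiE_mem[OF t], auto)
  have "k + card (off_diagonal t n) \<le> l" using chain_in_pairs[OF ch sub] len by simp
  then show k: "k = 0" "l = m - 1" "card (off_diagonal t n) = m - 1" using l off by linarith+
  show "filter (\<lambda>p. \<not> diagonal p) (path m t w) = map (\<lambda>a. (a, Suc a)) [0..<m - 1]"
  proof -
    have "\<forall>p\<in>set (path m t w). fst p \<le> snd p" using sub by (auto simp: pairs_def)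
    then have "filter (\<lambda>p. \<not> diagonal p) (path m t w) = map (\<lambda>a. (a, Suc a)) [k..<l]"
      using ch len k by (intro chain_tight) simp_all
    then show ?thesis by (simp only: k)
  qed
qed

text \<open>If \<open>t\<close> is not low, the path of \<open>w\<close> takes every step
  \<open>(a, a + 1)\<close> exactly once. Stars move the pair of a variable only within its orbit,
  so each orbit has as many variables as steps.\<close>

lemma hits_imp_top_or_low:
  assumes w: "w \<in> multilinear_words G n" and t: "t \<in> {1..n} \<rightarrow>\<^sub>E pairs m"
    and hit: "hits m gs t w k l" and l: "l < m"
  shows "t \<in> low_tests m n \<or> t \<in> top_tests m n \<and> k = 0 \<and> l = m - 1"
proof (cases "card (off_diagonal t n) + 2 \<le> m")
  case True
  then show ?thesis using t by (simp add: low_tests_def)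
next
  case False
  then have "m \<le> Suc (card (off_diagonal t n))" by simp
  note tight = tight_path[OF w t hit l this]
  have tp: "t i \<in> pairs m" if "i \<in> {1..n}" for i using t that by (rule PiE_mem)
  have "card {i \<in> {1..n}. t i \<in> step_class m c} = card (step_class m c)" for c
  proof -
    have "card {i \<in> {1..n}. t i \<in> step_class m c} = length (filter (\<lambda>p. p \<in> step_class m c) (path m t w))"
      using tp by (intro length_filter_path[OF w, symmetric]) simp
    also have "filter (\<lambda>p. p \<in> step_class m c) (path m t w)
      = filter (\<lambda>p. p \<in> step_class m c) (filter (\<lambda>p. \<not> diagonal p) (path m t w))"
      by (auto simp: step_class_def intro!: filter_cong)
    also have "length \<dots> = length (filter (\<lambda>a. fold_class m a = c) [0..<m - 1])"
      unfolding tight(3) by (auto simp: filter_map comp_def step_class_def intro!: arg_cong[where f = length] filter_cong)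
    also have "\<dots> = card {a. Suc a < m \<and> fold_class m a = c}"
      by (subst distinct_length_filter) (auto intro!: arg_cong[where f = card])
    finally show ?thesis by (simp add: card_step_class)
  qed
  moreover have "t i \<in> (\<lambda>a. (a, a)) ` {..<m} \<union> (\<Union>c<m div 2. step_class m c)" if i: "i \<in> {1..n}" for i
  proof (cases "diagonal (t i)")
    case True
    then show ?thesis using tp[OF i] by (cases "t i") (auto simp: pairs_def)
  next
    case False
    have "i \<in> indet_index ` set w" using w i by (simp add: multilinear_words_def)
    then obtain x where x: "x \<in> set w" "indet_index x = i" by auto
    let ?p = "reflect m (indet_starred x) (t i)"
    have "?p \<in> set (filter (\<lambda>p. \<not> diagonal p) (path m t w))"
      using x False tp[OF i] by (auto simp: path_def)
    then obtain a where a: "?p = (a, Suc a)" "a < m - 1" unfolding tight(3) by auto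
    then have "?p \<in> step_class m (fold_class m a)" by (auto simp: step_class_def)
    then have "t i \<in> step_class m (fold_class m a)" using tp[OF i] by simp
    moreover have "fold_class m a < m div 2" using a by (intro fold_class_less) simp
    ultimately show ?thesis by blast
  qed
  ultimately have "t \<in> top_tests m n" using t by (auto simp: top_tests_def PiE_def Pi_def)
  then show ?thesis using tight by simp
qed

text \<open>The degrees of the letters determine which of them are off-diagonal, and this determines a
  path whose steps all have length 1.\<close>

lemma hits_unique:
  assumes sep: "\<And>p q. p \<in> pairs m \<Longrightarrow> q \<in> pairs m \<Longrightarrow> pair_deg gs p = pair_deg gs q \<Longrightarrow> diagonal p \<longleftrightarrow> diagonal q"
    and w: "w \<in> multilinear_words G n"
    and t: "t \<in> {1..n} \<rightarrow>\<^sub>E pairs m" "hits m gs t w k l" "l < m"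
    and u: "u \<in> {1..n} \<rightarrow>\<^sub>E pairs m" "hits m gs u w k' l'" "l' < m"
    and off: "m \<le> Suc (card (off_diagonal t n))"
  shows "u = t" "k' = k" "l' = l"
proof -
  have tp: "t i \<in> pairs m" and up: "u i \<in> pairs m" if "i \<in> {1..n}" for i using t u that by auto
  have cover: "\<exists>x\<in>set w. indet_index x = i" if "i \<in> {1..n}" for i
  proof -
    have "i \<in> indet_index ` set w" using w that by (simp add: multilinear_words_def)
    then show ?thesis by auto
  qed
  \<comment> \<open>Both tests give the variable a pair of the degree of its letter, and by
    \<open>sep\<close> the degree tells diagonal from off-diagonal pairs.\<close>
  have diag: "diagonal (u i) \<longleftrightarrow> diagonal (t i)" if i: "i \<in> {1..n}" for i
  proof -
    obtain x where "x \<in> set w" "indet_index x = i" using cover[OF i] by auto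
    then have "pair_deg gs (u i) = pair_deg gs (t i)" using t(2) u(2) by (auto simp: hits_iff_chain)
    then show ?thesis using sep tp up i by blast
  qed
  then have "off_diagonal u n = off_diagonal t n" by (auto simp: off_diagonal_def)
  then have off': "m \<le> Suc (card (off_diagonal u n))" using off by simp
  note tight = tight_path[OF w t off] and tight' = tight_path[OF w u off']
  show "k' = k" "l' = l" using tight tight' by simp_all
  have steps: "\<forall>p\<in>set (path m v w). \<not> diagonal p \<longrightarrow> snd p = Suc (fst p)"
    if "filter (\<lambda>p. \<not> diagonal p) (path m v w) = map (\<lambda>a. (a, Suc a)) [0..<m - 1]" for v
  proof (intro ballI impI)
    fix p assume "p \<in> set (path m v w)" "\<not> diagonal p"
    then have "p \<in> set (filter (\<lambda>p. \<not> diagonal p) (path m v w))" by simp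
    then show "snd p = Suc (fst p)" unfolding that by auto
  qed
  have "path m t w = path m u w"
  proof (rule chain_unique)
    show "list_all2 (\<lambda>p q. diagonal p = diagonal q) (path m t w) (path m u w)"
      unfolding path_def list_all2_map1 list_all2_map2
      using diag tp up multilinear_words_index[OF w]
      by (auto simp: list_all2_same simp del: atLeastAtMost_iff)
    show "chain k l (path m t w)" "chain k l' (path m u w)"
      using t(2) u(2) \<open>k' = k\<close> by (auto simp: hits_iff_chain)
  qed (use steps tight(3) tight'(3) in blast)+
  \<comment> \<open>The letter fixes the star flag and reflection is an involution, so the common
    path gives back the value of the variable.\<close>
  have "u i = t i" if i: "i \<in> {1..n}" for i
  proof -
    obtain x where x: "x \<in> set w" "indet_index x = i" using cover[OF i] by auto
    then have "reflect m (indet_starred x) (t i) = reflect m (indet_starred x) (u i)"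
      using \<open>path m t w = path m u w\<close> by (auto simp: path_def)
    then have "reflect m (indet_starred x) (reflect m (indet_starred x) (t i))
      = reflect m (indet_starred x) (reflect m (indet_starred x) (u i))" by simp
    then show ?thesis using tp[OF i] up[OF i] by (auto simp: pairs_def)
  qed
  then show "u = t" using t(1) u(1) by (intro PiE_ext) auto
qed

text \<open>\<open>q i\<close> is the row of the step where the variable \<open>i\<close> will be
  placed. It exists because a top test has in each orbit as many variables as there are
  steps.\<close>

lemma top_tests_off_diagonal:
  assumes t: "t \<in> top_tests m n"
  shows "\<exists>q. bij_betw q (off_diagonal t n) {..<m - 1} \<and>
    (\<forall>i\<in>off_diagonal t n. fold_class m (q i) = fold_class m (fst (t i)))"
proof (rule bij_betw_from_fibres)
  fix c
  have tX: "t i \<in> (\<lambda>a. (a, a)) ` {..<m} \<union> (\<Union>c<m div 2. step_class m c)" if "i \<in> {1..n}" for i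
    using t that by (auto simp: top_tests_def)
  have "{i \<in> off_diagonal t n. fold_class m (fst (t i)) = c} = {i \<in> {1..n}. t i \<in> step_class m c}"
    using tX by (fastforce simp: off_diagonal_def step_class_def)
  moreover have "{a \<in> {..<m - 1}. fold_class m a = c} = {a. Suc a < m \<and> fold_class m a = c}" by auto
  moreover have "card {i \<in> {1..n}. t i \<in> step_class m c} = card (step_class m c)"
  proof (cases "c < m div 2")
    case True
    then show ?thesis using t by (simp add: top_tests_def)
  next
    case False
    then have "step_class m c = {}" using fold_class_less by (force simp: step_class_def)
    then show ?thesis by simp
  qed
  ultimately show "card {i \<in> off_diagonal t n. fold_class m (fst (t i)) = c} = card {a \<in> {..<m - 1}. fold_class m a = c}"
    by (simp add: card_step_class)
qed (auto simp: off_diagonal_def)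

text \<open>The variables are sorted along the path from row \<open>0\<close> to column \<open>m - 1\<close>; a star is put
  wherever the test matrix has to be reflected to fit into its place.\<close>

lemma top_tests_hit:
  assumes t: "t \<in> top_tests m n" and deg: "\<And>p. p \<in> pairs m \<Longrightarrow> pair_deg gs p \<in> G" and m: "m > 0"
  shows "\<exists>w\<in>multilinear_words G n. hits m gs t w 0 (m - 1)"
proof -
  have tp: "t i \<in> pairs m" if "i \<in> {1..n}" for i using t top_tests_subset that by blast
  obtain q where q: "bij_betw q (off_diagonal t n) {..<m - 1}"
    and fold_q: "\<And>i. i \<in> off_diagonal t n \<Longrightarrow> fold_class m (q i) = fold_class m (fst (t i))"
    using top_tests_off_diagonal[OF t] by blast
  \<comment> \<open>The diagonal matrices at row \<open>a\<close> come just before the step from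
    \<open>a\<close> to \<open>a + 1\<close>.\<close>
  define key where "key i = (if diagonal (t i) then 2 * fst (t i) else 2 * q i + 1)" for i
  define xs where "xs = sort_key key [1..<Suc n]"
  define letter where "letter i = Indet i (pair_deg gs (t i)) (\<not> diagonal (t i) \<and> t i \<noteq> (q i, Suc (q i)))" for i
  define w where "w = map letter xs"
  have xs: "distinct xs" "set xs = {1..n}"
    by (simp_all only: xs_def distinct_sort distinct_upt set_sort) auto
  have q_less: "q i < m - 1" if "i \<in> {1..n}" "\<not> diagonal (t i)" for i
    using q that by (auto simp: bij_betw_def off_diagonal_def)
  have "map indet_index w = xs" by (simp add: w_def letter_def comp_def)
  then have "w \<in> multilinear_words G n"
    using xs deg tp by (auto simp: multilinear_words_def w_def letter_def image_image)
  moreover have "path m t w = map (\<lambda>x. (x div 2, Suc x div 2)) (map key xs)"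
    unfolding path_def w_def map_map
  proof (rule map_cong[OF refl])
    fix i assume "i \<in> set xs"
    then have i: "i \<in> {1..n}" by (simp add: xs)
    show "((\<lambda>x. reflect m (indet_starred x) (t (indet_index x))) \<circ> letter) i = ((\<lambda>x. (x div 2, Suc x div 2)) \<circ> key) i"
    proof (cases "diagonal (t i)")
      case True
      then show ?thesis by (simp add: letter_def reflect_def key_def prod_eq_iff)
    next
      case False
      then have off: "i \<in> off_diagonal t n" using i by (simp add: off_diagonal_def)
      have "t i \<in> (\<lambda>a. (a, a)) ` {..<m} \<union> (\<Union>c<m div 2. step_class m c)"
        using t i by (auto simp: top_tests_def)
      then obtain b where b: "t i = (b, Suc b)" "Suc b < m" using False by (auto simp: step_class_def)
      have "fold_class m (q i) = fold_class m b" using fold_q[OF off] b by simp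
      have qi: "q i < m - 1" using i False by (rule q_less)
      show ?thesis
      proof (cases "b = q i")
        case True
        then show ?thesis using b by (simp add: letter_def reflect_def key_def)
      next
        case neq: False
        \<comment> \<open>Two different steps with the same class are mirror images of each
          other.\<close>
        have "b + q i = m - 2"
          using \<open>fold_class m (q i) = fold_class m b\<close> neq b(2) qi
          by (simp add: fold_class_def min_def split: if_splits)
        then have "m - 1 - Suc b = q i" "m - 1 - b = Suc (q i)" using b(2) qi by linarith+
        then show ?thesis using neq by (simp add: letter_def reflect_def key_def b(1))
      qed
    qed
  qed
  moreover have "chain 0 (m - 1) (map (\<lambda>x. (x div 2, Suc x div 2)) (map key xs))"
  proof (rule chain_of_sorted)
    show "sorted (map key xs)" unfolding xs_def by (rule sorted_sort_key)
    show "\<forall>x\<in>set (map key xs). 2 * 0 \<le> x \<and> x \<le> 2 * (m - 1)"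
    proof
      fix x assume "x \<in> set (map key xs)"
      then obtain i where i: "i \<in> {1..n}" "x = key i" by (auto simp: xs)
      have "fst (t i) < m" using tp[OF i(1)] by (auto simp: pairs_def)
      then show "2 * 0 \<le> x \<and> x \<le> 2 * (m - 1)" using i q_less[OF i(1)] by (auto simp: key_def)
    qed
    show "\<forall>a. 0 \<le> a \<and> a < m - 1 \<longrightarrow> count_list (map key xs) (2 * a + 1) = 1"
    proof (intro allI impI)
      fix a assume "0 \<le> a \<and> a < m - 1"
      then have "a \<in> q ` off_diagonal t n" using q by (simp add: bij_betw_def)
      then obtain i where i: "i \<in> off_diagonal t n" "q i = a" by blast
      \<comment> \<open>Keys of diagonal variables are even, and \<open>q\<close> is injective on
        the others.\<close>
      have "{j \<in> {1..n}. key j = 2 * a + 1} = {i}"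
      proof (intro equalityI subsetI)
        fix j assume j: "j \<in> {j \<in> {1..n}. key j = 2 * a + 1}"
        have "2 * fst (t j) \<noteq> 2 * a + 1" by presburger
        moreover have "key j = 2 * a + 1" using j by simp
        ultimately have "\<not> diagonal (t j)" "q j = a" by (simp_all add: key_def split: if_splits)
        then have "j \<in> off_diagonal t n" "q j = q i" using j i by (auto simp: off_diagonal_def)
        then show "j \<in> {i}" using q i(1) by (auto simp: bij_betw_def inj_on_def)
      qed (use i in \<open>auto simp: off_diagonal_def key_def\<close>)
      moreover have "count_list (map key xs) (2 * a + 1) = card {j \<in> {1..n}. key j = 2 * a + 1}"
      proof -
        have "count_list (map key xs) (2 * a + 1) = length (filter (\<lambda>j. key j = 2 * a + 1) xs)"
          by (simp only: count_list_eq_length_filter filter_map comp_def length_map eq_commute[of "2 * a + 1"])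
        also have "\<dots> = card ({j. key j = 2 * a + 1} \<inter> set xs)"
          by (rule distinct_length_filter[OF xs(1)])
        also have "{j. key j = 2 * a + 1} \<inter> set xs = {j \<in> {1..n}. key j = 2 * a + 1}"
          unfolding xs(2) by blast
        finally show ?thesis .
      qed
      ultimately show "count_list (map key xs) (2 * a + 1) = 1" by simp
    qed
  qed simp
  moreover have "\<forall>x\<in>set w. pair_deg gs (t (indet_index x)) = indet_deg x"
    by (auto simp: w_def letter_def)
  ultimately have "hits m gs t w 0 (m - 1)" by (simp only: hits_iff_chain simp_thms)
  then show ?thesis using \<open>w \<in> multilinear_words G n\<close> by blast
qed

lemma card_top_off_diagonal: "t \<in> top_tests m n \<Longrightarrow> card (off_diagonal t n) = m - 1"
  using top_tests_off_diagonal[of t m n] bij_betw_same_card by fastforce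

section \<open>Bounds by the numbers of tests\<close>

text \<open>Provides a common index set for the sums that belong to different polynomials; words
  outside the support contribute 0.\<close>

lemma test_value_superset:
  assumes "finite A" "Poly_Mapping.keys f \<subseteq> A"
  shows "test_value m gs f (t, k, l) = (\<Sum>w\<in>A. Poly_Mapping.lookup f w * of_bool (hits m gs t w k l))"
  unfolding test_value_def prod.case using assms
  by (intro sum.mono_neutral_left) (auto simp: in_keys_iff)

lemma test_value_add: "test_value m gs (f + g) s = test_value m gs f s + test_value m gs g s"
proof -
  obtain t k l where s: "s = (t, k, l)" by (cases s)
  let ?A = "Poly_Mapping.keys f \<union> Poly_Mapping.keys g"
  have sub: "Poly_Mapping.keys (f + g) \<subseteq> ?A" by (rule Poly_Mapping.keys_add)
  show ?thesis unfolding s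
    by (simp only: test_value_superset[of ?A] sub finite_UnI finite_keys Un_upper1 Un_upper2
        lookup_add distrib_right sum.distrib)
qed

lemma test_value_scale:
  "test_value m gs (Poly_Mapping.map ((*) c) f) s = c * test_value m gs f s"
proof -
  obtain t k l where s: "s = (t, k, l)" by (cases s)
  have sub: "Poly_Mapping.keys (Poly_Mapping.map ((*) c) f) \<subseteq> Poly_Mapping.keys f"
    by (auto simp: in_keys_iff)
  show ?thesis unfolding s
    by (simp only: test_value_superset[of "Poly_Mapping.keys f"] sub finite_keys order_refl
        lookup_map_mult sum_distrib_left mult.assoc)
qed

lemma finite_top_tests [simp]: "finite (top_tests m n)"
  by (rule finite_subset[OF top_tests_subset]) (auto intro: finite_PiE)

lemma finite_low_tests [simp]: "finite (low_tests m n)"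
  by (rule finite_subset[of _ "{1..n} \<rightarrow>\<^sub>E pairs m"]) (auto simp: low_tests_def intro: finite_PiE)

text \<open>The multilinear identities are the common kernel of the test values in
  \<open>?S\<close>, which contains every test and entry that a word can hit. A top test contributes
  the single entry \<open>(0, m - 1)\<close>, a low test \<open>m * m\<close> entries. For the lower
  bound, a word that hits a top test hits nothing else in \<open>?S\<close>, so it is dual to that
  test.\<close>

lemma star_codim_bounds:
  fixes ty :: "'f::field itself" and gs :: "'g::minus list" and n :: nat
  assumes sep: "\<And>p q. p \<in> pairs m \<Longrightarrow> q \<in> pairs m \<Longrightarrow> pair_deg gs p = pair_deg gs q \<Longrightarrow> diagonal p \<longleftrightarrow> diagonal q"
    and deg: "\<And>p. p \<in> pairs m \<Longrightarrow> pair_deg gs p \<in> G" and m: "m > 0"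
  defines "c \<equiv> star_codim (UT ty m) (reflection m) G (elementary_component ty m gs) n"
  shows "card (top_tests m n) \<le> c" "c \<le> card (top_tests m n) + card (low_tests m n) * (m * m)"
proof -
  let ?A = "free_star_algebra G :: ('f, 'g indet list \<Rightarrow>\<^sub>0 'f) module"
  let ?P = "multilinear_polys G n :: ('g indet list \<Rightarrow>\<^sub>0 'f) set"
  let ?V = "?A\<lparr>carrier := ?P\<rparr>"
  let ?T = "star_identities (UT ty m) (reflection m) G (elementary_component ty m gs)"
  let ?H = "top_tests m n \<times> {(0 :: nat, m - 1)}"
  let ?S = "?H \<union> low_tests m n \<times> {..<m} \<times> {..<m}"
  interpret A: vectorspace "class_ring :: 'f ring" ?A by (rule vectorspace_free_star_algebra)
  have "VectorSpace.subspace class_ring ?P ?A"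
    unfolding multilinear_polys_def multilinear_words_conv[symmetric]
  proof (rule A.span_is_subspace, clarify)
    fix \<sigma> :: "nat \<Rightarrow> nat" and g :: "nat \<Rightarrow> 'g" and \<delta> :: "nat \<Rightarrow> bool"
    assume "\<sigma> permutes {1..n}" "\<forall>k\<in>{1..n}. g k \<in> G"
    then have "map (\<lambda>k. Indet (\<sigma> k) (g k) (\<delta> k)) [1..<Suc n] \<in> multilinear_words G n"
      unfolding multilinear_words_conv by blast
    then show "Poly_Mapping.single (map (\<lambda>k. Indet (\<sigma> k) (g k) (\<delta> k)) [1..<Suc n]) 1 \<in> carrier ?A"
      by (auto simp: free_star_algebra_def multilinear_words_def simp del: upt_Suc)
  qed
  then have V: "vectorspace class_ring ?V" by (rule A.subspace_is_vs)
  have fin: "finite ?S" by simp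
  have S_sub: "t \<in> {1..n} \<rightarrow>\<^sub>E pairs m \<and> k < m \<and> l < m" if "(t, k, l) \<in> ?S" for t k l
    using that top_tests_subset m by (auto simp: low_tests_def)
  have outside: "test_value m gs f (t, k, l) = 0"
    if f: "f \<in> ?P" and t: "t \<in> {1..n} \<rightarrow>\<^sub>E pairs m" and kl: "k < m" "l < m" and S: "(t, k, l) \<notin> ?S"
    for f t k l
  proof -
    have "\<not> hits m gs t w k l" if "w \<in> Poly_Mapping.keys f" for w
    proof
      assume "hits m gs t w k l"
      moreover have "w \<in> multilinear_words G n" using f that by (auto simp: multilinear_polys_conv)
      ultimately have "t \<in> low_tests m n \<or> t \<in> top_tests m n \<and> k = 0 \<and> l = m - 1"
        using t kl by (intro hits_imp_top_or_low)
      then show False using S kl by auto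
    qed
    then show ?thesis unfolding test_value_def prod.case by (intro sum.neutral) simp
  qed
  have U: "?P \<inter> ?T = {f \<in> carrier ?V. \<forall>s\<in>?S. test_value m gs f s = 0}"
  proof -
    have "f \<in> ?T \<longleftrightarrow> (\<forall>s\<in>?S. test_value m gs f s = 0)" if f: "f \<in> ?P" for f
      unfolding multilinear_identity_iff[OF f m, of ty gs]
    proof
      assume *: "\<forall>t\<in>{1..n} \<rightarrow>\<^sub>E pairs m. \<forall>k<m. \<forall>l<m. test_value m gs f (t, k, l) = 0"
      show "\<forall>s\<in>?S. test_value m gs f s = 0"
      proof
        fix s assume s: "s \<in> ?S"
        obtain t k l where "s = (t, k, l)" by (cases s)
        then show "test_value m gs f s = 0" using * s S_sub by blast
      qed
    next
      assume "\<forall>s\<in>?S. test_value m gs f s = 0"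
      then show "\<forall>t\<in>{1..n} \<rightarrow>\<^sub>E pairs m. \<forall>k<m. \<forall>l<m. test_value m gs f (t, k, l) = 0"
        using outside[OF f] by blast
    qed
    then show ?thesis by auto
  qed
  note bounds = quotient_space_dim_bounds[OF V fin _ _ U]
  have c: "c = vectorspace.dim class_ring (quotient_space ?V (?P \<inter> ?T))"
    by (simp add: c_def star_codim_def)
  have "c \<le> card ?S"
    unfolding c by (rule bounds) (simp_all add: free_star_algebra_def test_value_add test_value_scale)
  also have "\<dots> \<le> card ?H + card (low_tests m n \<times> {..<m} \<times> {..<m})" by (rule card_Un_le)
  finally show "c \<le> card (top_tests m n) + card (low_tests m n) * (m * m)"
    by (simp add: card_cartesian_product)
  have "card ?H \<le> c"
    unfolding c
  proof (rule bounds)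
    fix s assume s: "s \<in> ?H"
    then obtain t where t: "t \<in> top_tests m n" "s = (t, 0, m - 1)" by auto
    obtain w where w: "w \<in> multilinear_words G n" "hits m gs t w 0 (m - 1)"
      using top_tests_hit[OF t(1) deg m] by blast
    have t_PiE: "t \<in> {1..n} \<rightarrow>\<^sub>E pairs m" using t(1) top_tests_subset by blast
    have "test_value m gs (Poly_Mapping.single w 1) s' = of_bool (s' = s)" if s': "s' \<in> ?S" for s'
    proof -
      obtain u k l where u: "s' = (u, k, l)" by (cases s')
      have u': "u \<in> {1..n} \<rightarrow>\<^sub>E pairs m" "l < m" using S_sub s' u by blast+
      have lt: "m - 1 < m" and off: "m \<le> Suc (card (off_diagonal t n))"
        using m card_top_off_diagonal[OF t(1)] by simp_all
      have unique: "u = t" "k = 0" "l = m - 1" if hit: "hits m gs u w k l"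
        by (rule hits_unique[OF _ w(1) t_PiE w(2) lt u'(1) hit u'(2) off], erule (2) sep)+
      have "hits m gs u w k l \<longleftrightarrow> s' = s"
      proof
        assume "s' = s"
        then show "hits m gs u w k l" using w(2) u t(2) by simp
      qed (use unique u t(2) in simp)
      then show ?thesis by (simp add: u test_value_def)
    qed
    moreover have "Poly_Mapping.single w 1 \<in> carrier ?V" using w by (simp add: multilinear_polys_conv)
    ultimately show "\<exists>v\<in>carrier ?V. \<forall>s'\<in>?S. test_value m gs v s' = of_bool (s' = s)" by blast
  qed (simp_all add: free_star_algebra_def test_value_add test_value_scale)
  then show "card (top_tests m n) \<le> c" by (simp add: card_cartesian_product)
qed


section \<open>Asymptotics\<close>

text \<open>The number of functions on \<open>n\<close> points into \<open>y\<close> free values and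
  \<open>q\<close> disjoint classes of sizes \<open>x c\<close> that take values in class
  \<open>c\<close> exactly \<open>k c\<close> times. The points for the last class are chosen
  first.\<close>

primrec count_by_classes :: "nat \<Rightarrow> (nat \<Rightarrow> nat) \<Rightarrow> (nat \<Rightarrow> nat) \<Rightarrow> nat \<Rightarrow> nat \<Rightarrow> nat" where
  "count_by_classes y x k 0 n = y ^ n"
| "count_by_classes y x k (Suc q) n =
     (n choose k q) * x q ^ k q * count_by_classes y x k q (n - k q)"

text \<open>Induction on the number of classes: once the set \<open>B\<close> of points sent to the
  last class is fixed, there remain an arbitrary function from \<open>B\<close> to
  \<open>X q\<close> and a function on \<open>A - B\<close> that involves only the first
  \<open>q\<close> classes.\<close>

lemma card_functions_with_counts:
  fixes Y :: "'b set" and X :: "nat \<Rightarrow> 'b set" and A :: "'a set"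
  assumes fin: "finite Y" "\<And>c. finite (X c)"
    and disj: "\<And>c. Y \<inter> X c = {}" "\<And>c d. c \<noteq> d \<Longrightarrow> X c \<inter> X d = {}"
    and A: "finite A"
  shows "card {t \<in> A \<rightarrow>\<^sub>E (Y \<union> (\<Union>c<q. X c)). \<forall>c<q. card {i \<in> A. t i \<in> X c} = k c}
    = count_by_classes (card Y) (\<lambda>c. card (X c)) k q (card A)"
  using A
proof (induction q arbitrary: A)
  case 0
  then show ?case by (simp add: card_PiE)
next
  case (Suc q)
  define Good where "Good q A = {t \<in> A \<rightarrow>\<^sub>E (Y \<union> (\<Union>c<q. X c)). \<forall>c<q. card {i \<in> A. t i \<in> X c} = k c}"
    for q and A :: "'a set"
  have fin_Good: "finite (Good q A)" if "finite A" for q and A :: "'a set"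
    unfolding Good_def using that fin by (intro finite_subset[OF _ finite_PiE[of A "\<lambda>_. Y \<union> (\<Union>c<q. X c)"]]) auto
  let ?Bs = "{B. B \<subseteq> A \<and> card B = k q}"
  define M where "M B = {t \<in> Good (Suc q) A. {i \<in> A. t i \<in> X q} = B}" for B
  have Good_Un: "Good (Suc q) A = (\<Union>B\<in>?Bs. M B)"
    by (auto simp: M_def Good_def)
  have card_M: "card (M B) = card (X q) ^ k q * count_by_classes (card Y) (\<lambda>c. card (X c)) k q (card A - k q)"
    if B: "B \<in> ?Bs" for B
  proof -
    have finB: "finite B" "finite (A - B)" using B Suc.prems by (auto intro: finite_subset)
    have part: "A = B \<union> (A - B)" "B \<inter> (A - B) = {}" using B by auto
    let ?to = "\<lambda>t. (restrict t B, restrict t (A - B))"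
    let ?from = "\<lambda>(f, g) i. if i \<in> B then f i else g i"
    have "bij_betw ?to (M B) ((B \<rightarrow>\<^sub>E X q) \<times> Good q (A - B))"
    proof (rule bij_betw_byWitness[where f' = ?from])
      show "\<forall>t\<in>M B. ?from (?to t) = t"
        by (auto simp: M_def Good_def PiE_def extensional_def restrict_def fun_eq_iff)
      show "\<forall>z\<in>(B \<rightarrow>\<^sub>E X q) \<times> Good q (A - B). ?to (?from z) = z"
        using B by (auto simp: Good_def PiE_def extensional_def restrict_def fun_eq_iff)
      show "?to ` M B \<subseteq> (B \<rightarrow>\<^sub>E X q) \<times> Good q (A - B)"
      proof (rule image_subsetI)
        fix t assume t: "t \<in> M B"
        have memB: "i \<in> B \<longleftrightarrow> i \<in> A \<and> t i \<in> X q" for i using t by (auto simp: M_def)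
        have tA: "t i \<in> Y \<union> (\<Union>c<Suc q. X c)" if "i \<in> A" for i using t that by (auto simp: M_def Good_def)
        have "restrict t (A - B) i \<in> Y \<union> (\<Union>c<q. X c)" if "i \<in> A - B" for i
          using tA[of i] that memB[of i] by (auto simp: less_Suc_eq)
        moreover have "card {i \<in> A - B. restrict t (A - B) i \<in> X c} = k c" if "c < q" for c
        proof -
          have "{i \<in> A - B. restrict t (A - B) i \<in> X c} = {i \<in> A. t i \<in> X c}"
            using disj(2)[of c q] that memB by auto
          then show ?thesis using t that by (simp add: M_def Good_def)
        qed
        ultimately have "restrict t (A - B) \<in> Good q (A - B)"
          unfolding Good_def by (intro CollectI conjI allI impI PiE_I) auto
        then show "?to t \<in> (B \<rightarrow>\<^sub>E X q) \<times> Good q (A - B)" using memB by auto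
      qed
      show "?from ` ((B \<rightarrow>\<^sub>E X q) \<times> Good q (A - B)) \<subseteq> M B"
      proof (rule image_subsetI)
        fix z assume "z \<in> (B \<rightarrow>\<^sub>E X q) \<times> Good q (A - B)"
        then obtain f g where z: "z = (f, g)" "f \<in> B \<rightarrow>\<^sub>E X q" "g \<in> Good q (A - B)" by auto
        have f: "f i \<in> X q" if "i \<in> B" for i using z that by auto
        have g: "g i \<in> Y \<union> (\<Union>c<q. X c)" if "i \<in> A - B" for i using z that by (auto simp: Good_def)
        \<comment> \<open>Disjointness makes \<open>B\<close> the exact fibre of the last class
          under the glued function.\<close>
        have gq: "g i \<notin> X q" if "i \<in> A - B" for i
          using g[OF that] disj by (auto simp: set_eq_iff) (metis nat_neq_iff)
        have fib: "{i \<in> A. ?from z i \<in> X q} = B"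
          using f gq B by (auto simp: z split: if_splits)
        have "card {i \<in> A. ?from z i \<in> X c} = k c" if "c < Suc q" for c
        proof (cases "c = q")
          case True
          then show ?thesis using fib B by simp
        next
          case False
          then have "{i \<in> A. ?from z i \<in> X c} = {i \<in> A - B. g i \<in> X c}"
            using f disj(2)[of c q] by (auto simp: z split: if_splits)
          then show ?thesis using z(3) that False by (simp add: Good_def)
        qed
        moreover have "?from z \<in> A \<rightarrow>\<^sub>E (Y \<union> (\<Union>c<Suc q. X c))"
        proof (rule PiE_I)
          fix i assume "i \<in> A"
          then show "?from z i \<in> Y \<union> (\<Union>c<Suc q. X c)" using f[of i] g[of i] by (auto simp: z less_Suc_eq)
        next
          fix i assume "i \<notin> A"
          then show "?from z i = undefined" using z(3) B by (auto simp: z(1) Good_def PiE_def extensional_def)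
        qed
        ultimately show "?from z \<in> M B" using fib by (auto simp: M_def Good_def)
      qed
    qed
    then have "card (M B) = card (B \<rightarrow>\<^sub>E X q) * card (Good q (A - B))"
      by (simp add: bij_betw_same_card card_cartesian_product)
    also have "card (B \<rightarrow>\<^sub>E X q) = card (X q) ^ k q" using B finB by (simp add: card_PiE)
    also have "card (Good q (A - B)) = count_by_classes (card Y) (\<lambda>c. card (X c)) k q (card A - k q)"
      using Suc.IH[OF finB(2)] B finB by (simp add: Good_def card_Diff_subset)
    finally show ?thesis .
  qed
  have "card (Good (Suc q) A) = (\<Sum>B\<in>?Bs. card (M B))"
    unfolding Good_Un
  proof (rule card_UN_disjoint)
    show "finite ?Bs" using Suc.prems by simp
    show "\<forall>B\<in>?Bs. finite (M B)" using fin_Good[OF Suc.prems] by (auto simp: M_def)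
    show "\<forall>B\<in>?Bs. \<forall>B'\<in>?Bs. B \<noteq> B' \<longrightarrow> M B \<inter> M B' = {}" by (auto simp: M_def)
  qed
  also have "\<dots> = (card A choose k q) * (card (X q) ^ k q * count_by_classes (card Y) (\<lambda>c. card (X c)) k q (card A - k q))"
    using card_M n_subsets[OF Suc.prems] by simp
  finally show ?case by (simp add: Good_def)
qed

section \<open>Asymptotics of the count\<close>

lemma binomial_asymp_equiv:
  "(\<lambda>n. real (n choose k)) \<sim>[at_top] (\<lambda>n. real n ^ k / fact k)"
proof (induction k)
  case 0
  then show ?case by simp
next
  case (Suc k)
  \<comment> \<open>The difference is taken in the reals. For \<open>n < k\<close> both binomial
    coefficients vanish, so the identity holds for all \<open>n\<close>.\<close>
  have eq: "real (n choose Suc k) = real (n choose k) * ((real n - real k) / real (Suc k))" for n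
  proof (cases "k \<le> n")
    case True
    have "Suc k * (n choose Suc k) = (n choose k) * (n - k)"
      by (metis binomial_absorb_comp mult.commute binomial_absorption)
    then have "real (Suc k) * real (n choose Suc k) = real (n choose k) * (real n - real k)"
      using True by (metis of_nat_diff of_nat_mult)
    then show ?thesis by (simp add: field_simps)
  next
    case False
    then have "n choose Suc k = 0" "n choose k = 0" by (simp_all add: binomial_eq_0)
    then show ?thesis by (simp del: binomial_eq_0_iff)
  qed
  have "(\<lambda>n. (real n - real k) / real (Suc k)) \<sim>[at_top] (\<lambda>n. real n / real (Suc k))"
    by real_asymp
  from asymp_equiv_mult[OF Suc this] show ?case
    unfolding eq by (simp add: field_simps)
qed

text \<open>Class \<open>c\<close> contributes \<open>n ^ k c / fact (k c)\<close> for the choice of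
  its points and \<open>x c ^ k c\<close> for their values; these points are lost for the free
  values, which costs a factor \<open>y ^ k c\<close>.\<close>

lemma count_by_classes_asymp_equiv:
  assumes y: "y > 0"
  shows "(\<lambda>n. real (count_by_classes y x k q n)) \<sim>[at_top]
    (\<lambda>n. (\<Prod>c<q. real (x c) ^ k c / fact (k c)) / real y ^ (\<Sum>c<q. k c)
          * real n ^ (\<Sum>c<q. k c) * real y ^ n)"
proof (induction q)
  case 0
  then show ?case by simp
next
  case (Suc q)
  define K where "K = (\<Sum>c<q. k c)"
  define C where "C = (\<Prod>c<q. real (x c) ^ k c / fact (k c)) / real y ^ K"
  have lim: "filterlim (\<lambda>n::nat. n - k q) at_top at_top"
    by (rule filterlim_minus_const_nat_at_top)
  have "(\<lambda>n. real (count_by_classes y x k q (n - k q))) \<sim>[at_top]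
      (\<lambda>n. C * real (n - k q) ^ K * real y ^ (n - k q))"
    using asymp_equiv_compose'[OF Suc lim] by (simp add: C_def K_def)
  \<comment> \<open>The shift by \<open>k q\<close> is negligible in the power of \<open>n\<close>,
    but leaves a constant factor in the exponential.\<close>
  also have "(\<lambda>n. C * real (n - k q) ^ K * real y ^ (n - k q)) \<sim>[at_top]
      (\<lambda>n. C * real n ^ K * (real y ^ n / real y ^ k q))"
  proof (intro asymp_equiv_intros)
    have "(\<lambda>n. real n - real (k q)) \<sim>[at_top] (\<lambda>n. real n)" by real_asymp
    moreover have "eventually (\<lambda>n. real n - real (k q) = real (n - k q)) at_top"
      using eventually_ge_at_top[of "k q"] by eventually_elim simp
    ultimately show "(\<lambda>n. real (n - k q)) \<sim>[at_top] (\<lambda>n. real n)"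
      by (rule asymp_equiv_transfer) simp
    show "(\<lambda>n. real y ^ (n - k q)) \<sim>[at_top] (\<lambda>n. real y ^ n / real y ^ k q)"
    proof (rule asymp_equiv_refl_ev)
      show "eventually (\<lambda>n. real y ^ (n - k q) = real y ^ n / real y ^ k q) at_top"
        using eventually_ge_at_top[of "k q"]
      proof eventually_elim
        case (elim n)
        then show ?case using y by (simp add: power_diff)
      qed
    qed
  qed
  finally have "(\<lambda>n. real (n choose k q) * real (x q) ^ k q * real (count_by_classes y x k q (n - k q))) \<sim>[at_top]
      (\<lambda>n. real n ^ k q / fact (k q) * real (x q) ^ k q * (C * real n ^ K * (real y ^ n / real y ^ k q)))"
    by (intro asymp_equiv_intros binomial_asymp_equiv)
  then show ?case
    by (simp add: C_def K_def[symmetric] power_add mult_ac)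
qed

section \<open>Numbers of top tests and low tests\<close>

text \<open>The orbit consists of the steps from \<open>c\<close> and from \<open>m - 2 - c\<close>,
  which coincide only for the middle step of an even \<open>m\<close>.\<close>

lemma card_step_class_value:
  assumes "c < m div 2"
  shows "card (step_class m c) = (if m = 2 * c + 2 then 1 else 2)"
proof -
  have "{a. Suc a < m \<and> fold_class m a = c} = {c, m - 2 - c}"
    using assms by (auto simp: fold_class_def min_def)
  moreover have "c = m - 2 - c \<longleftrightarrow> m = 2 * c + 2" using assms by linarith
  ultimately show ?thesis by (auto simp: card_step_class card_insert_if)
qed

text \<open>The size of an orbit appears twice: as the number of available values and as the number
  of variables that take them.\<close>

lemma card_top_tests:
  "card (top_tests m n) =
    count_by_classes m (\<lambda>c. card (step_class m c)) (\<lambda>c. card (step_class m c)) (m div 2) n"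
proof -
  have "card ((\<lambda>a. (a, a)) ` {..<m}) = m" by (simp add: card_image inj_on_def)
  moreover have "finite (step_class m c)" for c
    using step_class_subset finite_pairs by (rule finite_subset)
  ultimately show ?thesis
    unfolding top_tests_def using card_functions_with_counts[of "(\<lambda>a. (a, a)) ` {..<m}" "step_class m" "{1..n}"]
    by (force simp: step_class_def)
qed

text \<open>The orbits partition the \<open>m - 1\<close> steps. One of size 2 gives the factor
  \<open>2 ^ 2 / fact 2 = 2\<close>, one of size 1 the factor 1, and \<open>(m - 1) div 2\<close> of
  them have size 2.\<close>

lemma sum_prod_step_classes:
  assumes "m \<ge> 2"
  shows "(\<Sum>c<m div 2. card (step_class m c)) = m - 1"
    and "(\<Prod>c<m div 2. real (card (step_class m c)) ^ card (step_class m c) / fact (card (step_class m c)))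
      = 2 ^ ((m - 1) div 2)"
proof -
  let ?x = "\<lambda>c. card (step_class m c)"
  show "(\<Sum>c<m div 2. ?x c) = m - 1" and "(\<Prod>c<m div 2. real (?x c) ^ ?x c / fact (?x c)) = 2 ^ ((m - 1) div 2)"
  proof (atomize (full), cases "even m")
    case True
    then obtain r where r: "m = 2 * Suc r" using assms by (metis evenE not0_implies_Suc not_numeral_le_zero mult_0_right)
    have "?x c = 2" if "c < r" for c using that r by (subst card_step_class_value) auto
    moreover have "?x r = 1" using r by (subst card_step_class_value) auto
    moreover have "m div 2 = Suc r" "(m - 1) div 2 = r" using r by auto
    ultimately show "(\<Sum>c<m div 2. ?x c) = m - 1 \<and> (\<Prod>c<m div 2. real (?x c) ^ ?x c / fact (?x c)) = 2 ^ ((m - 1) div 2)"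
      using r by simp
  next
    case False
    then obtain r where r: "m = 2 * r + 1" by (metis oddE)
    have "?x c = 2" if "c < r" for c using that r by (subst card_step_class_value) auto
    then show "(\<Sum>c<m div 2. ?x c) = m - 1 \<and> (\<Prod>c<m div 2. real (?x c) ^ ?x c / fact (?x c)) = 2 ^ ((m - 1) div 2)"
      using r by simp
  qed
qed

lemma card_pairs_le: "card (pairs m) \<le> m * m"
proof -
  have "card (pairs m) \<le> card ({..<m} \<times> {..<m})"
    by (intro card_mono) (auto simp: pairs_def)
  then show ?thesis by (simp add: card_cartesian_product)
qed

lemma off_diagonal_subset: "off_diagonal t n \<subseteq> {1..n}"
  by (auto simp: off_diagonal_def)

text \<open>A crude count: choose \<open>m - 2\<close> variables that include all off-diagonal ones,
  which is possible as \<open>m - 2 \<le> n\<close>; allow any pair for these and the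
  \<open>m\<close> diagonal pairs for the others.\<close>

lemma card_low_tests_le:
  assumes m: "m \<ge> 2" and n: "m - 2 \<le> n"
  shows "card (low_tests m n) \<le> n ^ (m - 2) * (m * m) ^ (m - 2) * m ^ n"
proof -
  let ?D = "(\<lambda>a. (a, a)) ` {..<m}" and ?Bs = "{B. B \<subseteq> {1..n} \<and> card B = m - 2}"
  define L where "L B = (\<Pi>\<^sub>E i\<in>{1..n}. if i \<in> B then pairs m else ?D)" for B
  have finL: "finite (L B)" for B unfolding L_def by (intro finite_PiE) auto
  have "low_tests m n \<subseteq> (\<Union>B\<in>?Bs. L B)"
  proof
    fix t assume t: "t \<in> low_tests m n"
    then have "card (off_diagonal t n) \<le> m - 2" by (auto simp: low_tests_def)
    then obtain B where B: "off_diagonal t n \<subseteq> B" "B \<subseteq> {1..n}" "card B = m - 2"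
      using exists_subset_between[OF _ _ off_diagonal_subset, of t n "m - 2"] n by auto
    have "t \<in> L B"
      unfolding L_def
    proof (rule PiE_I)
      fix i assume i: "i \<in> {1..n}"
      then have "t i \<in> pairs m" using t by (auto simp: low_tests_def)
      moreover have "diagonal (t i)" if "i \<notin> B" using that i B(1) by (auto simp: off_diagonal_def)
      ultimately show "t i \<in> (if i \<in> B then pairs m else ?D)"
        by (cases "t i") (auto simp: pairs_def)
    qed (use t in \<open>auto simp: low_tests_def\<close>)
    then show "t \<in> (\<Union>B\<in>?Bs. L B)" using B by auto
  qed
  then have "card (low_tests m n) \<le> card (\<Union>B\<in>?Bs. L B)"
    using finL by (intro card_mono) auto
  also have "\<dots> \<le> (\<Sum>B\<in>?Bs. card (L B))" by (rule card_UN_le) simp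
  also have "\<dots> \<le> (\<Sum>B\<in>?Bs. (m * m) ^ (m - 2) * m ^ n)"
  proof (rule sum_mono)
    fix B assume B: "B \<in> ?Bs"
    have "card (L B) = (\<Prod>i\<in>{1..n}. if i \<in> B then card (pairs m) else card ?D)"
      unfolding L_def by (subst card_PiE) (auto intro: prod.cong)
    also have "\<dots> = card (pairs m) ^ card ({1..n} \<inter> B) * card ?D ^ card ({1..n} - B)"
      by (simp add: prod.If_cases Diff_eq)
    also have "{1..n} \<inter> B = B" using B by auto
    also have "card ?D = m" by (simp add: card_image inj_on_def)
    also have "card (pairs m) ^ card B * m ^ card ({1..n} - B) \<le> (m * m) ^ (m - 2) * m ^ n"
    proof (rule mult_mono)
      show "card (pairs m) ^ card B \<le> (m * m) ^ (m - 2)" using B card_pairs_le by (simp add: power_mono)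
      have "card ({1..n} - B) \<le> n" using card_mono[of "{1..n}" "{1..n} - B"] by simp
      then show "m ^ card ({1..n} - B) \<le> m ^ n" using m by (intro power_increasing) auto
    qed auto
    finally show "card (L B) \<le> (m * m) ^ (m - 2) * m ^ n" .
  qed
  also have "\<dots> = (n choose (m - 2)) * ((m * m) ^ (m - 2) * m ^ n)" by (simp add: n_subsets)
  also have "\<dots> \<le> n ^ (m - 2) * ((m * m) ^ (m - 2) * m ^ n)"
    using binomial_le_pow[OF n] by (rule mult_right_mono) simp
  finally show ?thesis by (simp add: mult.assoc)
qed

section \<open>The exponential growth rate\<close>

text \<open>Eventually \<open>f\<close> lies between one half and twice the comparison function, and
  the \<open>n\<close>-th roots of positive constants and of powers of \<open>n\<close> tend to
  1.\<close>

lemma root_limit_of_asymp_equiv: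
  fixes f :: "nat \<Rightarrow> real"
  assumes f: "f \<sim>[at_top] (\<lambda>n. K * real n ^ k * b ^ n)" and nonneg: "\<And>n. f n \<ge> 0" and pos: "K > 0" "b > 0"
  shows "(\<lambda>n. root n (f n)) \<longlonglongrightarrow> b"
proof -
  let ?g = "\<lambda>n. K * real n ^ k * b ^ n"
  have lim: "(\<lambda>n. root n (c * ?g n)) \<longlonglongrightarrow> b" if c: "c > 0" for c
  proof -
    have "(\<lambda>n. root n (c * K) * root n (real n) ^ k * b) \<longlonglongrightarrow> 1 * 1 ^ k * b"
      using c pos by (intro tendsto_intros LIMSEQ_root LIMSEQ_root_const) auto
    moreover have "eventually (\<lambda>n. root n (c * K) * root n (real n) ^ k * b = root n (c * ?g n)) at_top"
      using eventually_gt_at_top[of 0]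
    proof eventually_elim
      case (elim n)
      then show ?case using pos
        by (simp add: real_root_mult real_root_power[symmetric] real_root_power_cancel mult.assoc)
    qed
    ultimately show ?thesis by (simp add: tendsto_cong)
  qed
  have g_nonneg: "?g n \<ge> 0" for n using pos by simp
  show ?thesis
  proof (rule tendsto_sandwich)
    show "eventually (\<lambda>n. root n (1 / 2 * ?g n) \<le> root n (f n)) at_top"
      using asymp_equiv_imp_eventually_ge[OF f, of "1 / 2", simplified] eventually_gt_at_top[of 0]
    proof eventually_elim
      case (elim n)
      then show ?case using g_nonneg[of n] nonneg[of n] pos by (intro real_root_le_mono) (auto simp: abs_mult)
    qed
    show "eventually (\<lambda>n. root n (f n) \<le> root n (2 * ?g n)) at_top"
      using asymp_equiv_imp_eventually_le[OF f, of 2, simplified] eventually_gt_at_top[of 0]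
    proof eventually_elim
      case (elim n)
      then show ?case using g_nonneg[of n] nonneg[of n] pos by (intro real_root_le_mono) (auto simp: abs_mult)
    qed
  qed (intro lim; simp)+
qed

section \<open>The finest grading\<close>

text \<open>The zero vector belongs to the tuple even for \<open>m = 0\<close>, hence the
  assumption.\<close>

lemma finest_tuple_length:
  assumes "m > 0"
  shows "length (finest_tuple m) = m"
proof (cases "even m")
  case True
  then obtain r where r: "m = 2 * r" by (metis evenE)
  then have "r > 0" using assms by simp
  then show ?thesis by (simp add: r finest_tuple_def Let_def)
next
  case False
  then obtain r where r: "m = 2 * r + 1" by (metis oddE)
  then show ?thesis by (simp add: finest_tuple_def Let_def)
qed

lemma finest_tuple_carrier:
  assumes "v \<in> set (finest_tuple m)"
  shows "v \<in> carrier_vec (m div 2)"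
  using assms by (auto simp: finest_tuple_def Let_def split: if_splits)

text \<open>The vectors after the zero vector have a negative coordinate, unlike the zero vector and
  the unit vectors; among themselves they differ in the place of that coordinate.\<close>

lemma finest_tuple_distinct: "distinct (finest_tuple m)"
proof -
  define r where "r = m div 2"
  define vs :: "int vec list" where "vs = (if even m then map (\<lambda>i. unit_vec r (r - 1) - unit_vec r i) (rev [0..<r - 1])
      else map (\<lambda>i. - unit_vec r i) (rev [0..<r]))"
  have tuple: "finest_tuple m = map (unit_vec r) [0..<r] @ [0\<^sub>v r] @ vs"
    by (simp add: finest_tuple_def Let_def r_def vs_def)
  have neg: "\<exists>i<r. v $ i < 0" if v: "v \<in> set vs" for v
  proof (cases "even m")
    case True
    then obtain i where "i < r - 1" "v = unit_vec r (r - 1) - unit_vec r i"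
      using v by (auto simp: vs_def)
    then show ?thesis by (intro exI[of _ i]) simp
  next
    case False
    then obtain i where "i < r" "v = - unit_vec r i"
      using v by (auto simp: vs_def)
    then show ?thesis by (intro exI[of _ i]) simp
  qed
  have "i = j" if "i < r - 1" "j < r - 1"
    and eq: "unit_vec r (r - 1) - unit_vec r i = (unit_vec r (r - 1) - unit_vec r j :: int vec)" for i j
    using arg_cong[OF eq, of "\<lambda>v. v $ i"] that(1,2) by (simp split: if_splits)
  moreover have "i = j" if "i < r" "j < r" and eq: "- unit_vec r i = (- unit_vec r j :: int vec)" for i j
    using arg_cong[OF eq, of "\<lambda>v. v $ i"] that(1,2) by (simp split: if_splits)
  ultimately have "distinct vs"
    by (auto simp: vs_def distinct_map inj_on_def)
  moreover have "distinct (map (unit_vec r :: nat \<Rightarrow> int vec) [0..<r])"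
    by (auto simp: distinct_map inj_on_def)
  moreover have "unit_vec r i \<notin> set vs" if "i < r" for i
    using neg[of "unit_vec r i"] that by (auto split: if_splits)
  moreover have "0\<^sub>v r \<notin> set vs" using neg[of "0\<^sub>v r"] by auto
  moreover have False if "0\<^sub>v r = (unit_vec r i :: int vec)" "i < r" for i
    using arg_cong[OF that(1), of "\<lambda>v. v $ i"] that(2) by simp
  ultimately show ?thesis by (auto simp: tuple)
qed

text \<open>The entries of the tuple are distinct, so a pair has degree 0 exactly if it is
  diagonal.\<close>

lemma finest_tuple_separates:
  assumes "p \<in> pairs m" "q \<in> pairs m" "pair_deg (finest_tuple m) p = pair_deg (finest_tuple m) q"
  shows "diagonal p \<longleftrightarrow> diagonal q"
proof -
  let ?gs = "finest_tuple m" and ?r = "m div 2"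
  have len: "length ?gs = m" using assms(1) by (intro finest_tuple_length) (auto simp: pairs_def)
  have carr: "?gs ! a \<in> carrier_vec ?r" if "a < m" for a
    using that finest_tuple_carrier nth_mem len by metis
  have "pair_deg ?gs (a, b) = 0\<^sub>v ?r \<longleftrightarrow> a = b" if ab: "a < m" "b < m" for a b
  proof
    assume "pair_deg ?gs (a, b) = 0\<^sub>v ?r"
    then have "?gs ! a = ?gs ! b"
      using carr[OF ab(1)] carr[OF ab(2)]
      by (auto simp: pair_deg_def vec_eq_iff)
    then show "a = b" using ab finest_tuple_distinct len nth_eq_iff_index_eq by metis
  qed (use carr ab in \<open>auto simp: pair_deg_def\<close>)
  then show ?thesis using assms by (cases p; cases q) (auto simp: pairs_def, (metis le_less_trans)+)
qed

section \<open>Asymptotics of the codimensions and the exponent\<close>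

theorem theorem2p25:
  fixes m :: nat
    and F :: "'f::field_char_0 itself"
  assumes "m \<ge> 2"
  shows "(\<lambda>n. real (UT_codim F m n)) \<sim>[at_top]
           (\<lambda>n. (2 ^ ((m - 1) div 2) / real m ^ (m - 1)) * real n ^ (m - 1) * real m ^ n) \<and>
         convergent (\<lambda>n. root n (real (UT_codim F m n))) \<and>
         UT_exp F m = real m"
proof -
  let ?c = "\<lambda>n. UT_codim F m n" and ?K = "2 ^ ((m - 1) div 2) / real m ^ (m - 1)"
  let ?g = "\<lambda>n. ?K * real n ^ (m - 1) * real m ^ n"
  have m: "m > 0" using assms by simp
  have deg: "pair_deg (finest_tuple m) p \<in> carrier_vec (m div 2)" if "p \<in> pairs m" for p
    using that finest_tuple_carrier[OF nth_mem] m by (auto simp: pair_deg_def pairs_def finest_tuple_length)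
  have bounds: "card (top_tests m n) \<le> ?c n" "?c n \<le> card (top_tests m n) + card (low_tests m n) * (m * m)" for n
    unfolding UT_codim_def
    by (rule star_codim_bounds; (erule (2) finest_tuple_separates | erule deg | rule m))+
  let ?l = "\<lambda>n. real (card (top_tests m n))"
  \<comment> \<open>The bound of \<open>card_low_tests_le\<close>, times the \<open>m * m\<close>
    entries of each low test.\<close>
  let ?e = "\<lambda>n. real ((m * m) ^ (m - 2) * (m * m)) * real n ^ (m - 2) * real m ^ n"
  have l: "?l \<sim>[at_top] ?g"
    using count_by_classes_asymp_equiv[OF m, of "\<lambda>c. card (step_class m c)" "\<lambda>c. card (step_class m c)" "m div 2"]
    unfolding card_top_tests sum_prod_step_classes[OF assms] .
  \<comment> \<open>Low tests lose one power of \<open>n\<close>: the quotient is a constant divided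
    by \<open>n\<close>.\<close>
  have "?e \<in> o(?g)"
  proof (rule smalloI_tendsto)
    let ?C = "real ((m * m) ^ (m - 2) * (m * m))"
    have "(\<lambda>n. ?C / ?K * (1 / real n)) \<longlonglongrightarrow> ?C / ?K * 0"
      by (intro tendsto_intros lim_1_over_n)
    moreover have "eventually (\<lambda>n. ?C / ?K * (1 / real n) = ?e n / ?g n) at_top"
      using eventually_gt_at_top[of 0]
    proof eventually_elim
      case (elim n)
      have "real n ^ (m - 1) = real n * real n ^ (m - 2)"
        using assms by (metis Suc_1 Suc_diff_le diff_Suc_Suc power_Suc)
      then show ?case using elim m by (simp add: field_simps)
    qed
    ultimately show "(\<lambda>n. ?e n / ?g n) \<longlonglongrightarrow> 0" by (simp add: tendsto_cong)
    show "eventually (\<lambda>n. ?g n \<noteq> 0) at_top"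
      using eventually_gt_at_top[of 0] by eventually_elim (use m in simp)
  qed
  then have u: "(\<lambda>n. ?l n + ?e n) \<sim>[at_top] ?g" using l by (simp add: asymp_equiv_add_right)
  have main: "(\<lambda>n. real (?c n)) \<sim>[at_top] ?g"
  proof (rule asymp_equiv_sandwich_real[OF l u])
    \<comment> \<open>The bound for the low tests holds from \<open>n = m - 2\<close> on.\<close>
    show "eventually (\<lambda>n. real (?c n) \<in> {?l n..?l n + ?e n}) at_top"
      using eventually_ge_at_top[of "m - 2"]
    proof eventually_elim
      case (elim n)
      have "?c n \<le> card (top_tests m n) + card (low_tests m n) * (m * m)" by (rule bounds(2))
      also have "\<dots> \<le> card (top_tests m n) + n ^ (m - 2) * (m * m) ^ (m - 2) * m ^ n * (m * m)"
        using card_low_tests_le[OF assms elim] by (intro add_left_mono mult_right_mono) auto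
      finally have "real (?c n) \<le> real (card (top_tests m n) + n ^ (m - 2) * (m * m) ^ (m - 2) * m ^ n * (m * m))"
        by (rule of_nat_mono)
      then show ?case using bounds(1)[of n] by (simp add: mult_ac)
    qed
  qed
  moreover have lim: "(\<lambda>n. root n (real (?c n))) \<longlonglongrightarrow> real m"
    using main by (rule root_limit_of_asymp_equiv) (use m in auto)
  ultimately show ?thesis
    by (auto simp: convergent_def UT_exp_def star_exp_def limI simp flip: UT_codim_def)
qed

end
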